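(* Let $D$ be an H-domain. Then the following statements are equivalent. (1) $D[[X]]$ is a PVMD. (2) $D$ is completely integrally closed. (3) $D$ is a Krull domain. (4) $D[[X]]$ is completely integrally closed.
   Context: For an integral domain $R$ with quotient field $K$: for a nonzero fractional ideal $I$ put $I^{-1}=\{x\in K\mid xI\subseteq R\}$, $I_v=(I^{-1})^{-1}$, and $I_t=\bigcup\{J_v\mid J\subseteq I,\ J \text{ a nonzero finitely generated fractional ideal}\}$. $R$ is a PVMD (Prüfer $v$-multiplication domain) if $(II^{-1})_t=R$ for every nonzero finitely generated ideal $I$ of $R$. $R$ is completely integrally closed if whenever $x\in K$ and $0\ne r\in R$ satisfy $rx^n\in R$ for every integer $n\ge 1$, then $x\in R$. $R$ is an H-domain if for every nonzero ideal $I$ of $R$ with $I^{-1}=R$ there is a finitely generated ideal $F\subseteq I$ with $F^{-1}=R$ (equivalently, every maximal $t$-ideal of $R$ is divisorial, where a $t$-ideal is a nonzero fractional ideal $I$ with $I_t=I$, a maximal $t$-ideal is an ideal maximal among the $t$-ideals properly contained in $R$, and $I$ is divisorial if $I_v=I$). *)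

theory Defs
  imports "HOL-Computational_Algebra.Computational_Algebra"
begin

text \<open>
  The domain \<open>R\<close> is a type \<open>'a::idom\<close>, its quotient field is \<open>'a fract\<close>, and \<open>R\<close> is identified
  with its image in the quotient field, so ideals and fractional ideals of \<open>R\<close> are both
  \<open>R\<close>-submodules of \<open>'a fract\<close>. Properties of the domain as a whole are predicates on
  \<open>'a itself\<close>.
\<close>

global_interpretation fract: module "\<lambda>(r::'a::idom) (x::'a fract). to_fract r * x"
  defines fract_submodule = fract.subspace and fract_span = fract.span
  by unfold_locales (simp_all add: algebra_simps)

definition base_ring :: "'a::idom fract set" where
  "base_ring = range to_fract"

definition nonzero_fractional_ideal :: "'a::idom fract set \<Rightarrow> bool" where
  "nonzero_fractional_ideal I \<longleftrightarrow>
     fract_submodule I \<and> I \<noteq> {0} \<and> (\<exists>d. d \<noteq> 0 \<and> (\<forall>x\<in>I. to_fract d * x \<in> base_ring))"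

definition nonzero_ideal :: "'a::idom fract set \<Rightarrow> bool" where
  "nonzero_ideal I \<longleftrightarrow> fract_submodule I \<and> I \<noteq> {0} \<and> I \<subseteq> base_ring"

definition finitely_generated :: "'a::idom fract set \<Rightarrow> bool" where
  "finitely_generated I \<longleftrightarrow> (\<exists>A. finite A \<and> I = fract_span A)"

definition ideal_mult :: "'a::idom fract set \<Rightarrow> 'a fract set \<Rightarrow> 'a fract set" where
  "ideal_mult I J = fract_span {x * y | x y. x \<in> I \<and> y \<in> J}"

definition ideal_inverse :: "'a::idom fract set \<Rightarrow> 'a fract set" where
  "ideal_inverse I = {x. \<forall>y\<in>I. x * y \<in> base_ring}"

definition v_closure :: "'a::idom fract set \<Rightarrow> 'a fract set" where
  "v_closure I = ideal_inverse (ideal_inverse I)"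

definition t_closure :: "'a::idom fract set \<Rightarrow> 'a fract set" where
  "t_closure I =
     \<Union>{v_closure J | J. J \<subseteq> I \<and> nonzero_fractional_ideal J \<and> finitely_generated J}"

definition pvmd :: "'a::idom itself \<Rightarrow> bool" where
  "pvmd _ \<longleftrightarrow> (\<forall>I :: 'a fract set. nonzero_ideal I \<and> finitely_generated I \<longrightarrow>
     t_closure (ideal_mult I (ideal_inverse I)) = base_ring)"

definition completely_integrally_closed :: "'a::idom itself \<Rightarrow> bool" where
  "completely_integrally_closed _ \<longleftrightarrow>
     (\<forall>(x :: 'a fract) (r :: 'a).
        r \<noteq> 0 \<and> (\<forall>n\<ge>1. to_fract r * x ^ n \<in> base_ring) \<longrightarrow> x \<in> base_ring)"

definition H_domain :: "'a::idom itself \<Rightarrow> bool" where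
  "H_domain _ \<longleftrightarrow>
     (\<forall>I :: 'a fract set. nonzero_ideal I \<and> ideal_inverse I = base_ring \<longrightarrow>
        (\<exists>F \<subseteq> I. nonzero_ideal F \<and> finitely_generated F \<and> ideal_inverse F = base_ring))"

text \<open>
  Discrete (rank one, surjective onto the integers) valuations of a field. The value at \<open>0\<close>,
  conventionally infinite, is unconstrained and never used.
\<close>

definition discrete_valuation :: "('k::field \<Rightarrow> int) \<Rightarrow> bool" where
  "discrete_valuation v \<longleftrightarrow>
     (\<forall>x y. x \<noteq> 0 \<and> y \<noteq> 0 \<longrightarrow> v (x * y) = v x + v y) \<and>
     (\<forall>x y. x \<noteq> 0 \<and> y \<noteq> 0 \<and> x + y \<noteq> 0 \<longrightarrow> min (v x) (v y) \<le> v (x + y)) \<and>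
     v ` (- {0}) = UNIV"

definition discrete_valuation_ring_of :: "'k::field set \<Rightarrow> bool" where
  "discrete_valuation_ring_of V \<longleftrightarrow>
     (\<exists>v. discrete_valuation v \<and> V = {x. x = 0 \<or> 0 \<le> v x})"

text \<open>
  A Krull domain is an intersection of discrete valuation rings of its quotient field such that
  every nonzero element of the domain is a unit in all but finitely many of them. The empty
  family is allowed, so fields are Krull domains.
\<close>

definition krull_domain :: "'a::idom itself \<Rightarrow> bool" where
  "krull_domain _ \<longleftrightarrow>
     (\<exists>\<V> :: 'a fract set set.
        (\<forall>V\<in>\<V>. discrete_valuation_ring_of V) \<and>
        base_ring = \<Inter>\<V> \<and>
        (\<forall>x\<in>base_ring. x \<noteq> 0 \<longrightarrow> finite {V\<in>\<V>. inverse x \<notin> V}))"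

end

theory Submission
  imports Defs
begin

text \<open>
  Write \<open>K\<close> for the quotient field of \<open>D\<close>.

  Complete integral closedness passes between \<open>D\<close> and \<open>D[[X]]\<close> coefficient by coefficient: if
  \<open>r e\<^sup>m\<close> has coefficients in \<open>D\<close> for all \<open>m\<close>, then so do the products with the powers of the
  tails of \<open>e\<close>, and one compares lowest coefficients.

  Let \<open>D[[X]]\<close> be a PVMD and suppose \<open>r u\<^sup>n \<in> D\<close> for all \<open>n\<close> although \<open>u \<notin> D\<close>. If the
  conductor \<open>D : u\<close> is stable under \<open>u\<close>, then so is its extension \<open>(1, u)\<^sup>-\<^sup>1\<close> to
  \<open>D[[X]]\<close>, and invertibility gives \<open>u \<in> D\<close>. Otherwise there is \<open>a \<in> D\<close> with
  \<open>s = a u \<in> D\<close> and \<open>s u \<notin> D\<close>. The power series solution \<open>y\<close> of \<open>u y\<^sup>2 - y + u X = 0\<close> lies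
  in \<open>r\<^sup>-\<^sup>1 D[[X]]\<close>, and \<open>s y\<close> is integral over \<open>D[[X]]\<close> with \<open>s u\<close> as its coefficient at \<open>X\<close>,
  so \<open>D[[X]]\<close> is not integrally closed.

  Let \<open>D\<close> be a completely integrally closed H-domain. By Zorn's lemma every ideal with
  nontrivial inverse lies in a maximal one. Such a \<open>P\<close> is a prime of the form \<open>D : u\<close>. For
  \<open>r \<noteq> 0\<close> not all \<open>r u\<^sup>n\<close> lie in \<open>D\<close>, and the first \<open>n\<close> with \<open>r u\<^sup>n \<notin> P\<close> is the value of \<open>r\<close>
  under a discrete valuation with ring \<open>D\<^sub>P\<close>. These rings exhibit \<open>D\<close> as a Krull domain.

  Finally, if \<open>D\<close> is the intersection of discrete valuation rings \<open>V\<close> with finite character, then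
  \<open>D[[X]]\<close> is the intersection of the principal ideal domains \<open>K[[X]]\<close> and \<open>V((X))\<close>, again with
  finite character. Hence every ideal of \<open>D[[X]]\<close> has the same inverse as a finitely generated
  subideal, so \<open>D[[X]]\<close> is an H-domain. A completely integrally closed H-domain is a PVMD.
\<close>

section \<open>Ideals, inverses and PVMDs\<close>

lemma base_ring_0 [simp]: "0 \<in> base_ring"
  and base_ring_1 [simp]: "1 \<in> base_ring"
  and base_ring_to_fract [simp]: "to_fract a \<in> base_ring"
  unfolding base_ring_def by (auto simp flip: to_fract_0 to_fract_1)

lemma base_ring_add: "x \<in> base_ring \<Longrightarrow> y \<in> base_ring \<Longrightarrow> x + y \<in> base_ring"
  and base_ring_mult: "x \<in> base_ring \<Longrightarrow> y \<in> base_ring \<Longrightarrow> x * y \<in> base_ring"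
  and base_ring_uminus: "x \<in> base_ring \<Longrightarrow> - x \<in> base_ring"
  unfolding base_ring_def by (auto simp flip: to_fract_add to_fract_mult to_fract_uminus)

lemma base_ring_power: "x \<in> base_ring \<Longrightarrow> x ^ n \<in> base_ring"
  by (induction n) (auto intro: base_ring_mult)

lemma base_ring_of_nat: "of_nat n \<in> base_ring"
  by (induction n) (auto intro: base_ring_add)

lemma to_fract_power: "to_fract (a ^ n) = to_fract a ^ n"
  by (induction n) auto

lemma fract_cases:
  obtains c b where "b \<noteq> 0" "x = to_fract c / to_fract b"
  by (cases x) (auto simp: Fract_conv_to_fract)

lemma to_fract_divide_in_base_ring_iff:
  assumes "b \<noteq> 0"
  shows "to_fract c / to_fract b \<in> base_ring \<longleftrightarrow> b dvd c"
proof -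
  have "to_fract c / to_fract b = to_fract d \<longleftrightarrow> c = b * d" for d
    using assms by (simp add: divide_eq_eq mult.commute flip: to_fract_mult)
  then show ?thesis unfolding base_ring_def dvd_def by auto
qed

lemma fract_submoduleI:
  assumes "0 \<in> M" "\<And>x y. x \<in> M \<Longrightarrow> y \<in> M \<Longrightarrow> x + y \<in> M"
    "\<And>r x. r \<in> base_ring \<Longrightarrow> x \<in> M \<Longrightarrow> r * x \<in> M"
  shows "fract_submodule M"
  unfolding fract.subspace_def using assms by simp

lemma fract_submodule_mult:
  "fract_submodule M \<Longrightarrow> r \<in> base_ring \<Longrightarrow> x \<in> M \<Longrightarrow> r * x \<in> M"
  unfolding base_ring_def by (auto dest: fract.subspace_scale)

lemma fract_submodule_conductor: "fract_submodule {y. z * y \<in> base_ring}"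
  by (rule fract_submoduleI) (auto simp: distrib_left mult.left_commute intro: base_ring_add base_ring_mult)

lemma fract_submodule_base_ring: "fract_submodule base_ring"
  by (rule fract_submoduleI) (auto intro: base_ring_add base_ring_mult)

lemma mult_span_subset_base_ring:
  assumes "\<And>y. y \<in> A \<Longrightarrow> z * y \<in> base_ring" "x \<in> fract_span A"
  shows "z * x \<in> base_ring"
  using fract.span_minimal[OF _ fract_submodule_conductor[of z], of A] assms by blast

lemma ideal_inverse_antimono: "I \<subseteq> J \<Longrightarrow> ideal_inverse J \<subseteq> ideal_inverse I"
  unfolding ideal_inverse_def by blast

lemma base_ring_subset_ideal_inverse: "I \<subseteq> base_ring \<Longrightarrow> base_ring \<subseteq> ideal_inverse I"
  unfolding ideal_inverse_def by (auto intro: base_ring_mult)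

lemma ideal_inverse_base_ring: "ideal_inverse base_ring = base_ring"
proof -
  have "x \<in> base_ring" if "x \<in> ideal_inverse base_ring" for x :: "'a fract"
  proof -
    have "x * 1 \<in> base_ring" using that base_ring_1 unfolding ideal_inverse_def by blast
    then show ?thesis by simp
  qed
  then show ?thesis using base_ring_subset_ideal_inverse by blast
qed

text \<open>Writing \<open>x = c / b\<close> and clearing denominators moves the condition from the
  quotient field into the ring. Admitting the exponent 0 changes nothing, since \<open>r\<close>
  itself lies in the ring.\<close>

lemma completely_integrally_closed_iff_dvd:
  "completely_integrally_closed TYPE('a::idom) \<longleftrightarrow>
     (\<forall>r b c :: 'a. r \<noteq> 0 \<and> b \<noteq> 0 \<and> (\<forall>n. b ^ n dvd r * c ^ n) \<longrightarrow> b dvd c)"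
proof -
  have eq: "to_fract r * (to_fract c / to_fract b) ^ n \<in> base_ring \<longleftrightarrow> b ^ n dvd r * c ^ n"
    if "b \<noteq> 0" for r b c :: 'a and n
    using to_fract_divide_in_base_ring_iff[of "b ^ n" "r * c ^ n"] that
    by (simp add: to_fract_power power_divide)
  have n1: "(\<forall>n\<ge>1. P n) \<longleftrightarrow> (\<forall>n. P n)" if "P 0" for P :: "nat \<Rightarrow> bool"
    using that by (metis One_nat_def Suc_leI neq0_conv)
  show ?thesis (is "?L = ?R")
  proof
    assume L: ?L
    show ?R
    proof (intro allI impI)
      fix r b c :: 'a assume *: "r \<noteq> 0 \<and> b \<noteq> 0 \<and> (\<forall>n. b ^ n dvd r * c ^ n)"
      then have "to_fract c / to_fract b \<in> base_ring"
        using L[unfolded completely_integrally_closed_def] eq by blast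
      with * show "b dvd c" by (simp add: to_fract_divide_in_base_ring_iff)
    qed
  next
    assume R: ?R
    show ?L unfolding completely_integrally_closed_def
    proof (intro allI impI)
      fix x :: "'a fract" and r :: 'a
      assume *: "r \<noteq> 0 \<and> (\<forall>n\<ge>1. to_fract r * x ^ n \<in> base_ring)"
      obtain c b where x: "b \<noteq> 0" "x = to_fract c / to_fract b" by (rule fract_cases)
      have "\<forall>n. to_fract r * x ^ n \<in> base_ring"
        using * by (subst n1[symmetric]) auto
      then have "b dvd c" using R * x eq by blast
      then show "x \<in> base_ring" using x by (simp add: to_fract_divide_in_base_ring_iff)
    qed
  qed
qed

text \<open>Each \<open>y\<close> in the inverse of \<open>I = (p, q)\<close> yields a pair
  \<open>h = y * p\<close>, \<open>k = y * q\<close>, so \<open>dvd\<close> says that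
  \<open>z = m / n\<close> multiplies the product of \<open>I\<close> and its inverse into the ring.
  By the PVMD property some \<open>J\<close> inside that product has 1 in its v-closure. Then
  \<open>z\<close> lies in the inverse of \<open>J\<close>, hence \<open>1 * z\<close> in the
  ring.\<close>

lemma pvmd_dvdD:
  fixes p q m n :: "'a::idom"
  assumes pvmd: "pvmd TYPE('a)" and "p \<noteq> 0" "n \<noteq> 0"
    and dvd: "\<And>h k. h * q = k * p \<Longrightarrow> n dvd m * h \<and> n dvd m * k"
  shows "n dvd m"
proof -
  define I where "I = fract_span {to_fract p, to_fract q}"
  have "to_fract p \<in> I" unfolding I_def by (simp add: fract.span_base)
  then have "I \<noteq> {0}" using \<open>p \<noteq> 0\<close> by auto
  moreover have "I \<subseteq> base_ring"
    unfolding I_def by (rule fract.span_minimal) (auto simp: fract_submodule_base_ring)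
  moreover have "finitely_generated I" unfolding finitely_generated_def I_def
    by (intro exI[of _ "{to_fract p, to_fract q}"]) simp
  moreover have "fract_submodule I" unfolding I_def by (rule fract.subspace_span)
  ultimately have "nonzero_ideal I" "finitely_generated I"
    unfolding nonzero_ideal_def by blast+
  with pvmd have "1 \<in> t_closure (ideal_mult I (ideal_inverse I))"
    unfolding pvmd_def by simp
  then obtain J where J: "J \<subseteq> ideal_mult I (ideal_inverse I)" "1 \<in> v_closure J"
    unfolding t_closure_def by blast
  define z where "z = to_fract m / to_fract n"
  have z: "z * (x * y) \<in> base_ring" if x: "x \<in> I" and y: "y \<in> ideal_inverse I" for x y
  proof -
    have y': "y * to_fract p \<in> base_ring" "y * to_fract q \<in> base_ring"
      using y fract.span_base unfolding I_def ideal_inverse_def by blast+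
    then obtain h k where hk: "y * to_fract p = to_fract h" "y * to_fract q = to_fract k"
      unfolding base_ring_def by blast
    have "to_fract (h * q) = to_fract (k * p)"
      by (simp flip: hk)
    then have "h * q = k * p" by (simp only: to_fract_eq_iff)
    then have "to_fract (m * h) / to_fract n \<in> base_ring" "to_fract (m * k) / to_fract n \<in> base_ring"
      using dvd \<open>n \<noteq> 0\<close> by (auto simp: to_fract_divide_in_base_ring_iff simp del: to_fract_mult)
    then have "(z * y) * to_fract p \<in> base_ring" "(z * y) * to_fract q \<in> base_ring"
      by (simp_all add: z_def mult.assoc hk)
    then have "(z * y) * x \<in> base_ring"
      using x mult_span_subset_base_ring[of "{to_fract p, to_fract q}" "z * y" x] unfolding I_def by auto
    then show ?thesis by (simp add: mult_ac)
  qed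
  have "z * w \<in> base_ring" if "w \<in> J" for w
    using J(1) that z mult_span_subset_base_ring[of "{x * y |x y. x \<in> I \<and> y \<in> ideal_inverse I}" z w]
    unfolding ideal_mult_def by blast
  then have "z \<in> ideal_inverse J" unfolding ideal_inverse_def by blast
  then have "1 * z \<in> base_ring" using J(2) unfolding v_closure_def ideal_inverse_def by blast
  then show ?thesis using \<open>n \<noteq> 0\<close> by (simp add: z_def to_fract_divide_in_base_ring_iff)
qed

text \<open>Any \<open>x\<close> in the inverse of \<open>J\<close> maps the inverse of
  \<open>I\<close> into itself. As that inverse contains 1, it contains all powers of
  \<open>x\<close>, and a nonzero element of \<open>I\<close> is a common denominator for them. So
  \<open>J\<close> has trivial inverse, and the H-property supplies \<open>F\<close> with trivial
  v-closure.\<close>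

lemma pvmd_if_completely_integrally_closed_H_domain:
  assumes cic: "completely_integrally_closed TYPE('a::idom)" and H: "H_domain TYPE('a)"
  shows "pvmd TYPE('a)"
  unfolding pvmd_def
proof (intro allI impI)
  fix I :: "'a fract set" assume I: "nonzero_ideal I \<and> finitely_generated I"
  define J where "J = ideal_mult I (ideal_inverse I)"
  have IB: "I \<subseteq> base_ring" using I unfolding nonzero_ideal_def by blast
  have prod_in_J: "x * y \<in> J" if "x \<in> I" "y \<in> ideal_inverse I" for x y
    using that unfolding J_def ideal_mult_def by (blast intro: fract.span_base)
  have one: "1 \<in> ideal_inverse I"
    using base_ring_subset_ideal_inverse[OF IB] by auto
  have IJ: "I \<subseteq> J" using prod_in_J[OF _ one] by auto
  have "J \<subseteq> base_ring"
    unfolding J_def ideal_mult_def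
    by (rule fract.span_minimal)
      (auto simp: fract_submodule_base_ring ideal_inverse_def mult.commute)
  moreover have "0 \<in> I" using I fract.subspace_0 unfolding nonzero_ideal_def by blast
  ultimately have J: "nonzero_ideal J"
    using I IJ fract.subspace_span unfolding nonzero_ideal_def J_def ideal_mult_def by blast
  have "ideal_inverse J \<subseteq> base_ring"
  proof
    fix x assume x: "x \<in> ideal_inverse J"
    have step: "x * y \<in> ideal_inverse I" if "y \<in> ideal_inverse I" for y
    proof -
      have "x * y * w \<in> base_ring" if "w \<in> I" for w
      proof -
        have "x * (w * y) \<in> base_ring"
          using x prod_in_J[OF that \<open>y \<in> ideal_inverse I\<close>] unfolding ideal_inverse_def by blast
        then show ?thesis by (simp add: ac_simps)
      qed
      then show ?thesis unfolding ideal_inverse_def by blast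
    qed
    have pow: "x ^ n \<in> ideal_inverse I" for n
      by (induction n) (use one step in auto)
    obtain y where "y \<in> I" "y \<noteq> 0"
      using I \<open>0 \<in> I\<close> unfolding nonzero_ideal_def by blast
    then obtain r where r: "to_fract r \<in> I" "r \<noteq> 0"
      using IB unfolding base_ring_def by fastforce
    have "to_fract r * x ^ n \<in> base_ring" for n
      using pow[of n] r(1) unfolding ideal_inverse_def by (simp add: mult.commute)
    then show "x \<in> base_ring"
      using cic r(2) unfolding completely_integrally_closed_def by blast
  qed
  then have "ideal_inverse J = base_ring"
    using base_ring_subset_ideal_inverse[OF \<open>J \<subseteq> base_ring\<close>] by blast
  then obtain F where F: "F \<subseteq> J" "nonzero_ideal F" "finitely_generated F"
    "ideal_inverse F = base_ring"
    using H J unfolding H_domain_def by blast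
  have "v_closure F = base_ring" unfolding v_closure_def F(4) by (rule ideal_inverse_base_ring)
  moreover have "nonzero_fractional_ideal F"
    using F(2) unfolding nonzero_ideal_def nonzero_fractional_ideal_def
    by (auto intro!: exI[of _ 1])
  ultimately have "base_ring \<subseteq> t_closure J"
    unfolding t_closure_def using F by blast
  moreover have "v_closure G \<subseteq> base_ring" if "G \<subseteq> J" for G
    using that \<open>J \<subseteq> base_ring\<close> ideal_inverse_antimono[of "base_ring" "ideal_inverse G"]
      base_ring_subset_ideal_inverse[of G]
    unfolding v_closure_def ideal_inverse_base_ring by blast
  then have "t_closure J \<subseteq> base_ring" unfolding t_closure_def by blast
  ultimately show "t_closure (ideal_mult I (ideal_inverse I)) = base_ring"
    unfolding J_def by blast
qed

section \<open>Complete integral closedness of power series rings\<close>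

definition fps_to_fract :: "'a::idom fps \<Rightarrow> 'a fract fps" where
  "fps_to_fract f = Abs_fps (\<lambda>n. to_fract (f $ n))"

text \<open>The parameter \<open>S\<close> runs over the base ring and over valuation rings of K.
  Quotients are first formed in K[[X]], then their coefficients are located in
  \<open>S\<close>.\<close>

definition fps_over :: "'k::field set \<Rightarrow> 'k fps set" where
  "fps_over S = {f. \<forall>n. f $ n \<in> S}"

lemma fps_to_fract_nth [simp]: "fps_to_fract f $ n = to_fract (f $ n)"
  by (simp add: fps_to_fract_def)

lemma fps_to_fract_mult: "fps_to_fract (f * g) = fps_to_fract f * fps_to_fract g"
  by (simp add: fps_eq_iff fps_mult_nth)

lemma fps_to_fract_add: "fps_to_fract (f + g) = fps_to_fract f + fps_to_fract g"
  by (simp add: fps_eq_iff)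

lemma fps_to_fract_const: "fps_to_fract (fps_const c) = fps_const (to_fract c)"
  by (simp add: fps_eq_iff)

lemma fps_to_fract_X: "fps_to_fract fps_X = fps_X"
  by (simp add: fps_eq_iff fps_X_def)

lemma fps_to_fract_eq_iff [simp]: "fps_to_fract f = fps_to_fract g \<longleftrightarrow> f = g"
  by (simp add: fps_eq_iff)

lemma fps_to_fract_eq_0_iff [simp]: "fps_to_fract f = 0 \<longleftrightarrow> f = 0"
  by (simp add: fps_eq_iff)

lemma subdegree_fps_to_fract [simp]: "subdegree (fps_to_fract f) = subdegree f"
proof (cases "f = 0")
  case True
  then show ?thesis by (metis fps_to_fract_eq_0_iff subdegree_0)
qed (auto intro!: subdegreeI)

lemma fps_to_fract_power: "fps_to_fract (f ^ n) = fps_to_fract f ^ n"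
proof (induction n)
  case 0
  then show ?case by (simp add: fps_eq_iff fps_one_nth)
qed (simp add: fps_to_fract_mult)

lemma range_fps_to_fract: "range fps_to_fract = fps_over base_ring"
proof -
  have "f \<in> range fps_to_fract" if "f \<in> fps_over base_ring" for f :: "'a fract fps"
  proof -
    have "\<exists>g. \<forall>n. f $ n = to_fract (g n)"
      using that unfolding fps_over_def base_ring_def by (intro choice) auto
    then obtain g where "\<And>n. f $ n = to_fract (g n)" by blast
    then have "f = fps_to_fract (Abs_fps g)" by (simp add: fps_eq_iff)
    then show ?thesis by blast
  qed
  then show ?thesis by (auto simp: fps_over_def)
qed

lemma fps_to_fract_in_fps_over_base_ring [simp]: "fps_to_fract f \<in> fps_over base_ring"
  by (simp add: fps_over_def)

lemma fps_to_fract_dvdD: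
  assumes "fps_to_fract f * e = fps_to_fract g" "e \<in> fps_over base_ring"
  shows "f dvd g"
proof -
  obtain h where "e = fps_to_fract h" using assms(2) range_fps_to_fract by blast
  with assms(1) have "f * h = g" by (simp flip: fps_to_fract_mult)
  then show ?thesis by auto
qed

section \<open>Power series with coefficients in a subring of a field\<close>

definition is_subring :: "'k::field set \<Rightarrow> bool" where
  "is_subring S \<longleftrightarrow> 0 \<in> S \<and> 1 \<in> S \<and>
     (\<forall>x\<in>S. \<forall>y\<in>S. x + y \<in> S \<and> x * y \<in> S) \<and> (\<forall>x\<in>S. - x \<in> S)"

lemma is_subring_base_ring: "is_subring base_ring"
  by (simp add: is_subring_def base_ring_add base_ring_mult base_ring_uminus)

lemma is_subring_sum:
  "is_subring S \<Longrightarrow> (\<And>i. i \<in> A \<Longrightarrow> f i \<in> S) \<Longrightarrow> sum f A \<in> S"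
  by (induction A rule: infinite_finite_induct) (auto simp: is_subring_def)

lemma fps_over_0: "is_subring S \<Longrightarrow> 0 \<in> fps_over S"
  by (simp add: fps_over_def is_subring_def)

lemma fps_over_const: "is_subring S \<Longrightarrow> c \<in> S \<Longrightarrow> fps_const c \<in> fps_over S"
  by (simp add: fps_over_def is_subring_def)

lemma fps_over_X_power: "is_subring S \<Longrightarrow> fps_X ^ n \<in> fps_over S"
  by (simp add: fps_over_def is_subring_def)

lemma fps_over_add:
  "is_subring S \<Longrightarrow> f \<in> fps_over S \<Longrightarrow> g \<in> fps_over S \<Longrightarrow> f + g \<in> fps_over S"
  by (simp add: fps_over_def is_subring_def)

lemma fps_over_uminus: "is_subring S \<Longrightarrow> f \<in> fps_over S \<Longrightarrow> - f \<in> fps_over S"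
  by (simp add: fps_over_def is_subring_def)

lemma fps_over_mult:
  assumes "is_subring S" "f \<in> fps_over S" "g \<in> fps_over S"
  shows "f * g \<in> fps_over S"
proof -
  have "(f * g) $ n \<in> S" for n
    unfolding fps_mult_nth using assms
    by (intro is_subring_sum) (auto simp: is_subring_def fps_over_def)
  then show ?thesis by (simp add: fps_over_def)
qed

lemma fps_over_sum:
  "is_subring S \<Longrightarrow> (\<And>i. i \<in> A \<Longrightarrow> f i \<in> fps_over S) \<Longrightarrow> sum f A \<in> fps_over S"
  by (simp add: fps_over_def fps_sum_nth is_subring_sum)

lemma fps_over_power: "is_subring S \<Longrightarrow> f \<in> fps_over S \<Longrightarrow> f ^ n \<in> fps_over S"
proof (induction n)
  case 0
  then show ?case using fps_over_X_power[of S 0] by simp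
qed (simp add: fps_over_mult)

lemma fps_over_X_power_multD: "fps_X ^ n * f \<in> fps_over S \<Longrightarrow> f \<in> fps_over S"
proof -
  assume "fps_X ^ n * f \<in> fps_over S"
  then have "(fps_X ^ n * f) $ (n + i) \<in> S" for i by (simp add: fps_over_def)
  then show "f \<in> fps_over S" by (simp add: fps_over_def fps_X_power_mult_nth)
qed

section \<open>Transfer of complete integral closedness between D and D[[X]]\<close>

lemma nth_subdegree_mult_power:
  fixes r f :: "'k::field fps"
  shows "(r * f ^ m) $ subdegree r = r $ subdegree r * (f $ 0) ^ m"
  by (subst fps_mult_nth_conv_upto_subdegree_left) (simp add: fps_power_zeroth)

lemma fps_over_base_ring_if_powers:
  fixes r e :: "'a::idom fract fps"
  assumes cic: "completely_integrally_closed TYPE('a)"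
    and r: "r \<in> fps_over base_ring" "r \<noteq> 0"
    and pow: "\<And>m. r * e ^ m \<in> fps_over base_ring"
  shows "e \<in> fps_over base_ring"
proof -
  have "e $ n \<in> base_ring" for n
  proof (induction n rule: less_induct)
    case (less n)
    define d where "d = fps_cutoff n e"
    define e' where "e' = fps_shift n e"
    have d: "d \<in> fps_over base_ring" using less by (auto simp: d_def fps_over_def)
    have ed: "fps_X ^ n * e' = e + (- d)"
      using fps_shift_cutoff'[of n e] by (simp add: d_def e'_def algebra_simps)
    \<comment> \<open>Up to a shift by \<open>fps_X ^ (n * m)\<close> this is
      \<open>r * (e - d) ^ m\<close>, whose binomial expansion consists of terms
      \<open>r * e ^ k\<close> multiplied by series over D.\<close>
    have pow': "r * e' ^ m \<in> fps_over base_ring" for m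
    proof -
      have "fps_X ^ (n * m) * (r * e' ^ m) = r * (fps_X ^ n * e') ^ m"
        unfolding power_mult_distrib power_mult by (rule mult.left_commute)
      also have "\<dots> = r * (\<Sum>k\<le>m. of_nat (m choose k) * e ^ k * (- d) ^ (m - k))"
        unfolding ed binomial_ring ..
      also have "\<dots> = (\<Sum>k\<le>m. fps_const (of_nat (m choose k)) * ((r * e ^ k) * (- d) ^ (m - k)))"
        by (simp add: sum_distrib_left fps_of_nat mult_ac)
      also have "\<dots> \<in> fps_over base_ring"
        by (intro fps_over_sum fps_over_mult[OF _ fps_over_const[OF _ base_ring_of_nat]]
          fps_over_mult[OF _ pow] fps_over_power fps_over_uminus d is_subring_base_ring)
      finally show ?thesis by (rule fps_over_X_power_multD)
    qed
    \<comment> \<open>The constant term of \<open>e'\<close> is \<open>e $ n\<close>, so the lowest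
      coefficient \<open>r0\<close> of \<open>r\<close> is a common denominator for the powers of
      \<open>e $ n\<close>.\<close>
    obtain r0 where r0: "r $ subdegree r = to_fract r0"
      using r(1) unfolding fps_over_def base_ring_def by auto
    have "r0 \<noteq> 0" using r(2) r0 nth_subdegree_nonzero[of r] by auto
    moreover have "to_fract r0 * (e $ n) ^ m \<in> base_ring" for m
      using pow'[of m] nth_subdegree_mult_power[of r e' m] unfolding fps_over_def r0 e'_def
      by (metis (mono_tags, lifting) add_0 fps_shift_nth mem_Collect_eq)
    ultimately show ?case
      using cic unfolding completely_integrally_closed_def by blast
  qed
  then show ?thesis by (simp add: fps_over_def)
qed

text \<open>Comparing orders shows that the quotient \<open>e = c / b\<close> exists in K[[X]]. The
  series \<open>r\<close> is then a common denominator for the powers of \<open>e\<close>.\<close>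

theorem completely_integrally_closed_fps:
  assumes cic: "completely_integrally_closed TYPE('a::idom)"
  shows "completely_integrally_closed TYPE('a fps)"
  unfolding completely_integrally_closed_iff_dvd
proof (intro allI impI)
  fix r b c :: "'a fps"
  assume *: "r \<noteq> 0 \<and> b \<noteq> 0 \<and> (\<forall>n. b ^ n dvd r * c ^ n)"
  show "b dvd c"
  proof (cases "c = 0")
    case False
    have deg: "n * subdegree b \<le> subdegree r + n * subdegree c" for n
    proof -
      have "b ^ n dvd r * c ^ n" using * by blast
      then obtain k where k: "r * c ^ n = b ^ n * k" ..
      then have "k \<noteq> 0" using * False by auto
      then show ?thesis using arg_cong[OF k, of subdegree] * False by simp
    qed
    \<comment> \<open>Otherwise each power adds at least one to the gap in \<open>deg\<close>, and
      the exponent \<open>subdegree r + 1\<close> exceeds what \<open>r\<close> can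
      compensate.\<close>
    have "subdegree b \<le> subdegree c"
    proof (rule ccontr)
      assume "\<not> ?thesis"
      then have "Suc (subdegree c) \<le> subdegree b" by simp
      then have "Suc (subdegree r) * Suc (subdegree c) \<le> Suc (subdegree r) * subdegree b"
        by (rule mult_le_mono2)
      then show False using deg[of "Suc (subdegree r)"] by simp
    qed
    have "fps_to_fract b dvd fps_to_fract c"
      using * False \<open>subdegree b \<le> subdegree c\<close> by (subst fps_dvd_iff) auto
    then obtain e where e: "fps_to_fract c = fps_to_fract b * e" ..
    have pow: "fps_to_fract r * e ^ n \<in> fps_over base_ring" for n
    proof -
      obtain k where k: "r * c ^ n = b ^ n * k" using * by blast
      have "fps_to_fract b ^ n * (fps_to_fract r * e ^ n) = fps_to_fract (r * c ^ n)"
        by (simp add: fps_to_fract_mult fps_to_fract_power e power_mult_distrib mult_ac)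
      also have "\<dots> = fps_to_fract b ^ n * fps_to_fract k"
        by (simp add: k fps_to_fract_mult fps_to_fract_power)
      finally show ?thesis using * by simp
    qed
    have "fps_to_fract r \<noteq> 0" using * by simp
    then have "e \<in> fps_over base_ring"
      by (rule fps_over_base_ring_if_powers[OF cic fps_to_fract_in_fps_over_base_ring _ pow])
    with e show ?thesis using fps_to_fract_dvdD[of b e c] by simp
  qed auto
qed

lemma fps_const_dvd_iff: "fps_const c dvd f \<longleftrightarrow> (\<forall>n. c dvd f $ n)" for c :: "'a::idom"
proof
  assume "\<forall>n. c dvd f $ n"
  then have "\<exists>g. \<forall>n. f $ n = c * g n" by (intro choice) (auto simp: dvd_def)
  then obtain g where "\<And>n. f $ n = c * g n" by blast
  then have "f = fps_const c * Abs_fps g" by (simp add: fps_eq_iff)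
  then show "fps_const c dvd f" by simp
qed auto

text \<open>Divisibility by a constant is decided coefficient by coefficient, so a counterexample in
  D remains one as constant series.\<close>

theorem completely_integrally_closed_if_fps:
  assumes cic: "completely_integrally_closed TYPE('a::idom fps)"
  shows "completely_integrally_closed TYPE('a)"
  unfolding completely_integrally_closed_iff_dvd
proof (intro allI impI)
  fix r b c :: 'a
  assume *: "r \<noteq> 0 \<and> b \<noteq> 0 \<and> (\<forall>n. b ^ n dvd r * c ^ n)"
  then have "fps_const b ^ n dvd fps_const r * fps_const c ^ n" for n
    by (auto simp: fps_const_power fps_const_dvd_iff)
  moreover have "fps_const r \<noteq> 0" "fps_const b \<noteq> 0" using * by auto
  ultimately have "fps_const b dvd fps_const c"
    using cic[unfolded completely_integrally_closed_iff_dvd] by blast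
  then show "b dvd c" by (metis fps_const_dvd_iff fps_nth_fps_const)
qed

section \<open>Power series rings that are PVMDs\<close>

fun catalan :: "nat \<Rightarrow> nat" where
  "catalan 0 = 1"
| "catalan (Suc n) = (\<Sum>i\<le>n. catalan i * catalan (n - i))"

text \<open>The series \<open>Y / r\<close> is the solution \<open>y\<close> of \<open>u y\<^sup>2 - y + u X = 0\<close> without constant term.\<close>

lemma catalan_quadratic:
  fixes u r :: "'a::idom fract"
  defines "Y \<equiv> Abs_fps (\<lambda>n. case n of 0 \<Rightarrow> 0 | Suc k \<Rightarrow> of_nat (catalan k) * (r * u ^ (2 * k + 1)))"
  shows "fps_const u * Y ^ 2 + fps_const (r ^ 2 * u) * fps_X = fps_const r * Y"
proof (rule fps_ext)
  fix n
  have Y: "Y $ 0 = 0" "\<And>k. Y $ Suc k = of_nat (catalan k) * (r * u ^ (2 * k + 1))"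
    by (simp_all add: Y_def)
  show "(fps_const u * Y ^ 2 + fps_const (r ^ 2 * u) * fps_X) $ n = (fps_const r * Y) $ n"
  proof (cases n)
    case 0
    then show ?thesis by (simp add: Y power2_eq_square)
  next
    case (Suc m)
    show ?thesis
    proof (cases m)
      case 0
      then show ?thesis
        by (simp add: Suc Y power2_eq_square fps_mult_nth[of Y Y] fps_mult_fps_X_commute)
    next
      case m: (Suc k)
      have "(Y ^ 2) $ n = (\<Sum>i=0..n. Y $ i * Y $ (n - i))"
        by (simp add: power2_eq_square fps_mult_nth)
      \<comment> \<open>The first and the last term of the convolution vanish because
        \<open>Y\<close> has no constant term.\<close>
      also have "\<dots> = (\<Sum>i=0..m. Y $ Suc i * Y $ (m - i))"
        unfolding Suc by (subst sum.atLeast0_atMost_Suc_shift) (simp add: Y)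
      also have "\<dots> = (\<Sum>i=0..k. Y $ Suc i * Y $ Suc (k - i))"
        unfolding m by (simp add: Y Suc_diff_le)
      also have "\<dots> = (\<Sum>i=0..k. of_nat (catalan i * catalan (k - i)) * (r ^ 2 * u ^ (2 * m)))"
      proof (rule sum.cong)
        fix i assume "i \<in> {0..k}"
        \<comment> \<open>The exponents of \<open>u\<close> add up to the same number for every
          \<open>i\<close>, which leaves the Catalan recurrence.\<close>
        then have "2 * m = 2 * i + 1 + (2 * (k - i) + 1)" using m by auto
        then show "Y $ Suc i * Y $ Suc (k - i) =
            of_nat (catalan i * catalan (k - i)) * (r ^ 2 * u ^ (2 * m))"
          by (simp only: Y power_add) (simp add: power2_eq_square)
      qed simp
      also have "\<dots> = of_nat (catalan m) * (r ^ 2 * u ^ (2 * m))"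
        unfolding m by (simp add: atLeast0AtMost sum_distrib_right)
      finally show ?thesis
        by (simp add: Suc m Y power2_eq_square)
    qed
  qed
qed

theorem completely_integrally_closed_if_pvmd_fps:
  assumes pvmd: "pvmd TYPE('a::idom fps)"
  shows "completely_integrally_closed TYPE('a)"
  unfolding completely_integrally_closed_iff_dvd
proof (intro allI impI)
  fix r b c :: 'a
  assume *: "r \<noteq> 0 \<and> b \<noteq> 0 \<and> (\<forall>n. b ^ n dvd r * c ^ n)"
  define u where "u = to_fract c / to_fract b"
  have u: "to_fract r * u ^ n \<in> base_ring" for n
    using * to_fract_divide_in_base_ring_iff[of "b ^ n" "r * c ^ n"]
    by (simp add: u_def to_fract_power power_divide)
  have bu: "to_fract b * u = to_fract c" using * by (simp add: u_def)
  show "b dvd c"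
  proof (rule ccontr)
    assume ndvd: "\<not> b dvd c"
    then have u_notin: "u \<notin> base_ring"
      using * by (simp add: u_def to_fract_divide_in_base_ring_iff)
    have "\<exists>a s. to_fract a * u = to_fract s \<and> to_fract s * u \<notin> base_ring"
    proof (rule ccontr)
      assume "\<not> ?thesis"
      then have stable: "to_fract s * u \<in> base_ring" if "to_fract a * u = to_fract s" for a s
        using that by blast
      \<comment> \<open>Here \<open>pvmd_dvdD\<close> is applied to the ideal (b, c) and the
        fraction \<open>c / b = u\<close>. A pair (h, k) satisfies \<open>k = u h\<close>
        coefficientwise, so \<open>u h\<close> is integral at once and \<open>u k\<close> by
        stability.\<close>
      have "fps_const b dvd fps_const c"
      proof (rule pvmd_dvdD[OF pvmd, of "fps_const b" _ "fps_const c"])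
        fix h k assume hk: "h * fps_const c = k * fps_const b"
        have "to_fract (h $ n) * u = to_fract (k $ n)" for n
        proof -
          have "h $ n * c = k $ n * b" using arg_cong[OF hk, of "\<lambda>f. f $ n"] by simp
          then have "to_fract (h $ n) * to_fract c = to_fract (k $ n) * to_fract b"
            by (simp flip: to_fract_mult)
          then show ?thesis using * by (simp add: u_def divide_eq_eq)
        qed
        then have "to_fract (c * h $ n) / to_fract b \<in> base_ring"
          "to_fract (c * k $ n) / to_fract b \<in> base_ring" for n
          using stable[of "h $ n" "k $ n"] by (simp_all add: u_def mult.commute)
        then have "b dvd c * h $ n" "b dvd c * k $ n" for n
          using * by (simp_all add: to_fract_divide_in_base_ring_iff del: to_fract_mult)
        then show "fps_const b dvd fps_const c * h \<and> fps_const b dvd fps_const c * k"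
          by (simp add: fps_const_dvd_iff)
      qed (use * in auto)
      then show False using ndvd by (metis fps_const_dvd_iff fps_nth_fps_const)
    qed
    then obtain a s where s: "to_fract a * u = to_fract s" "to_fract s * u \<notin> base_ring" by blast
    \<comment> \<open>This is \<open>r\<close> times the Catalan solution of the quadratic; the
      factor \<open>r\<close> is what makes every coefficient lie in D.\<close>
    define Y' where "Y' = Abs_fps (\<lambda>n. case n of 0 \<Rightarrow> 0
      | Suc k \<Rightarrow> of_nat (catalan k) * (to_fract r * u ^ (2 * k + 1)))"
    have "Y' \<in> fps_over base_ring"
      unfolding fps_over_def Y'_def using u
      by (auto split: nat.split intro!: base_ring_mult[OF base_ring_of_nat] simp del: power_Suc)
    then obtain Y where Y: "Y' = fps_to_fract Y" using range_fps_to_fract by blast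
    \<comment> \<open>Multiplying by \<open>a\<close> turns \<open>u\<close> into
      \<open>s = a u\<close>, so the equation descends to D[[X]].\<close>
    have "fps_const (to_fract a) * (fps_const u * Y' ^ 2 + fps_const (to_fract r ^ 2 * u) * fps_X) =
        fps_const (to_fract a) * (fps_const (to_fract r) * Y')"
      unfolding Y'_def by (subst catalan_quadratic) simp
    then have "fps_const (to_fract s) * Y' ^ 2 + fps_const (to_fract (r ^ 2 * s)) * fps_X =
        fps_const (to_fract (a * r)) * Y'"
      unfolding s(1)[symmetric] to_fract_mult power2_eq_square fps_const_mult[symmetric]
      by (simp only: algebra_simps)
    then have "fps_to_fract (fps_const s * Y ^ 2 + fps_const (r ^ 2 * s) * fps_X) =
        fps_to_fract (fps_const (a * r) * Y)"
      unfolding Y fps_to_fract_add fps_to_fract_mult fps_to_fract_power fps_to_fract_const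
        fps_to_fract_X .
    then have quad: "fps_const s * Y ^ 2 + fps_const (r ^ 2 * s) * fps_X = fps_const (a * r) * Y"
      by (simp only: fps_to_fract_eq_iff)
    \<comment> \<open>\<open>s Y / r\<close> is a root of the monic polynomial \<open>Z\<^sup>2 - a Z + s\<^sup>2 X\<close>.\<close>
    have "fps_const r dvd fps_const s * Y"
    proof (rule pvmd_dvdD[OF pvmd, of "fps_const r" _ "fps_const s * Y"])
      show r0: "fps_const r \<noteq> 0" and "fps_const r \<noteq> 0" using * by auto
      fix h k assume hk: "h * (fps_const s * Y) = k * fps_const r"
      show "fps_const r dvd fps_const s * Y * h \<and> fps_const r dvd fps_const s * Y * k"
      proof
        have key: "fps_const s * Y * h = fps_const r * k" using hk by (simp add: mult_ac)
        then show "fps_const r dvd fps_const s * Y * h" by simp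
        \<comment> \<open>Multiplied by \<open>r\<close>, the product becomes \<open>s h\<close>
          times \<open>s Y^2\<close>. By \<open>quad\<close> and \<open>key\<close> this is
          divisible by \<open>r\<close> twice, and one factor cancels.\<close>
        have "fps_const r * (fps_const s * Y * k) = fps_const s * Y * (fps_const s * Y * h)"
          unfolding key by (simp only: mult_ac)
        also have "\<dots> = fps_const s * h * (fps_const s * Y ^ 2)"
          by (simp only: power2_eq_square mult_ac)
        also have "fps_const s * Y ^ 2 = fps_const (a * r) * Y - fps_const (r ^ 2 * s) * fps_X"
          by (simp flip: quad)
        also have "fps_const s * h * \<dots> = fps_const r *
            (fps_const a * (fps_const s * Y * h) - fps_const r * (fps_const s * fps_const s * h * fps_X))"
          unfolding power2_eq_square fps_const_mult[symmetric] by (simp only: algebra_simps)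
        also have "\<dots> = fps_const r *
            (fps_const r * (fps_const a * k - fps_const s * fps_const s * h * fps_X))"
          unfolding key by (simp only: algebra_simps)
        finally have "fps_const s * Y * k =
            fps_const r * (fps_const a * k - fps_const s * fps_const s * h * fps_X)"
          using r0 by simp
        then show "fps_const r dvd fps_const s * Y * k" by simp
      qed
    qed
    \<comment> \<open>Since \<open>Y $ 1\<close> is \<open>r u\<close>, the coefficient of
      \<open>s Y / r\<close> at X is \<open>s u\<close>, which was chosen outside D.\<close>
    then have "r dvd (fps_const s * Y) $ 1" using fps_const_dvd_iff by blast
    then obtain d where "s * Y $ 1 = r * d" by (auto simp: dvd_def)
    then have "to_fract s * to_fract (Y $ 1) = to_fract r * to_fract d" by (simp flip: to_fract_mult)
    moreover have "to_fract (Y $ 1) = to_fract r * u"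
      using arg_cong[OF Y, of "\<lambda>f. f $ 1"] by (simp add: Y'_def)
    ultimately have "to_fract s * u = to_fract d" using * by simp
    then show False using s(2) by simp
  qed
qed

section \<open>The discrete valuations of a completely integrally closed H-domain\<close>

definition conductor :: "'a::idom fract \<Rightarrow> 'a fract set" where
  "conductor u = {r \<in> base_ring. r * u \<in> base_ring}"

text \<open>Maximality ranges over all ideals with nontrivial inverse, not just over conductors;
  \<open>maximal_conductor_eq_conductor\<close> justifies the name.\<close>

definition maximal_conductor :: "'a::idom fract set \<Rightarrow> bool" where
  "maximal_conductor P \<longleftrightarrow> nonzero_ideal P \<and> ideal_inverse P \<noteq> base_ring \<and>
     (\<forall>I. nonzero_ideal I \<and> ideal_inverse I \<noteq> base_ring \<and> P \<subseteq> I \<longrightarrow> I = P)"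

definition localization :: "'a::idom fract set \<Rightarrow> 'a fract set" where
  "localization P = {w / t | w t. w \<in> base_ring \<and> t \<in> base_ring - P}"

lemma nonzero_ideal_iff:
  "nonzero_ideal I \<longleftrightarrow> fract_submodule I \<and> I \<subseteq> base_ring \<and> (\<exists>x\<in>I. x \<noteq> 0)"
  unfolding nonzero_ideal_def using fract.subspace_0 by blast

lemma nonzero_ideal_conductor: "nonzero_ideal (conductor u)"
proof -
  obtain c b where b: "b \<noteq> 0" "u = to_fract c / to_fract b" by (rule fract_cases)
  then have "to_fract b \<in> conductor u" by (simp add: conductor_def)
  moreover have "fract_submodule (conductor u)" unfolding conductor_def
    by (rule fract_submoduleI)
      (auto simp: distrib_right mult.assoc intro: base_ring_add base_ring_mult)
  moreover have "to_fract b \<noteq> 0" using b by simp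
  moreover have "conductor u \<subseteq> base_ring" by (auto simp: conductor_def)
  ultimately show ?thesis unfolding nonzero_ideal_iff by blast
qed

lemma ideal_inverse_conductor:
  assumes "u \<notin> base_ring"
  shows "ideal_inverse (conductor u) \<noteq> base_ring"
proof -
  have "u \<in> ideal_inverse (conductor u)"
    by (auto simp: ideal_inverse_def conductor_def mult.commute)
  with assms show ?thesis by blast
qed

text \<open>Any \<open>u\<close> in the inverse of \<open>P\<close> but outside D works: its
  conductor contains \<open>P\<close> and has nontrivial inverse, so maximality forces
  equality.\<close>

lemma maximal_conductor_eq_conductor:
  assumes P: "maximal_conductor P"
  obtains u where "u \<notin> base_ring" "P = conductor u"
proof -
  have "P \<subseteq> base_ring" using P unfolding maximal_conductor_def nonzero_ideal_def by blast
  then have "base_ring \<subseteq> ideal_inverse P" by (rule base_ring_subset_ideal_inverse)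
  then obtain u where u: "u \<in> ideal_inverse P" "u \<notin> base_ring"
    using P unfolding maximal_conductor_def by blast
  have "P \<subseteq> conductor u"
    using u(1) \<open>P \<subseteq> base_ring\<close> by (auto simp: ideal_inverse_def conductor_def mult.commute)
  then have "P = conductor u"
    using P nonzero_ideal_conductor ideal_inverse_conductor[OF u(2)]
    unfolding maximal_conductor_def by blast
  with u(2) show thesis by (rule that)
qed

text \<open>If \<open>a\<close> is outside \<open>P = conductor u\<close>, then \<open>a * u\<close>
  is outside D, and its conductor contains \<open>P\<close>, hence equals \<open>P\<close>. But
  \<open>a * b \<in> P\<close> puts \<open>b\<close> into that conductor.\<close>

lemma maximal_conductor_prime:
  assumes P: "maximal_conductor P" and "a \<in> base_ring" "b \<in> base_ring" "a * b \<in> P"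
  shows "a \<in> P \<or> b \<in> P"
proof (rule ccontr)
  assume ab: "\<not> ?thesis"
  obtain u where u: "u \<notin> base_ring" "P = conductor u"
    using P by (rule maximal_conductor_eq_conductor)
  have "a * u \<notin> base_ring" using ab u(2) \<open>a \<in> base_ring\<close> by (auto simp: conductor_def)
  moreover have "P \<subseteq> conductor (a * u)"
    using \<open>a \<in> base_ring\<close> base_ring_mult
    by (fastforce simp: u(2) conductor_def mult.left_commute)
  ultimately have "conductor (a * u) = P"
    using P nonzero_ideal_conductor ideal_inverse_conductor unfolding maximal_conductor_def by blast
  moreover have "b \<in> conductor (a * u)"
    using assms(3,4) u(2) by (simp add: conductor_def mult_ac)
  ultimately show False using ab by blast
qed

text \<open>The H-property keeps unions of chains admissible: a union with trivial inverse would
  contain a finitely generated ideal with trivial inverse, whose generators already lie in one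
  member of the chain.\<close>

lemma exists_maximal_conductor:
  fixes I :: "'a::idom fract set"
  assumes H: "H_domain TYPE('a)" and I: "nonzero_ideal I" "ideal_inverse I \<noteq> base_ring"
  obtains P where "maximal_conductor P" "I \<subseteq> P"
proof -
  define \<A> :: "'a fract set set"
    where "\<A> = {J. nonzero_ideal J \<and> ideal_inverse J \<noteq> base_ring \<and> I \<subseteq> J}"
  have "\<exists>M\<in>\<A>. \<forall>X\<in>\<A>. M \<subseteq> X \<longrightarrow> X = M"
  proof (rule subset_Zorn_nonempty)
    show "\<A> \<noteq> {}" using I unfolding \<A>_def by blast
  next
    fix \<C> assume ne: "\<C> \<noteq> {}" and chain: "subset.chain \<A> \<C>"
    have sub: "\<C> \<subseteq> \<A>" and lin: "\<And>X Y. X \<in> \<C> \<Longrightarrow> Y \<in> \<C> \<Longrightarrow> X \<subseteq> Y \<or> Y \<subseteq> X"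
      using chain unfolding subset_chain_def by auto
    have subm: "fract_submodule X" if "X \<in> \<C>" for X
      using that sub unfolding \<A>_def nonzero_ideal_def by blast
    have "fract_submodule (\<Union>\<C>)"
    proof (rule fract_submoduleI)
      show "0 \<in> \<Union>\<C>" using ne subm fract.subspace_0 by blast
    next
      fix x y assume "x \<in> \<Union>\<C>" "y \<in> \<Union>\<C>"
      then obtain X where "X \<in> \<C>" "x \<in> X" "y \<in> X" using lin by blast
      then show "x + y \<in> \<Union>\<C>" using subm fract.subspace_add by blast
    next
      fix r x :: "'a fract" assume "r \<in> base_ring" "x \<in> \<Union>\<C>"
      then show "r * x \<in> \<Union>\<C>" using subm fract_submodule_mult by blast
    qed
    moreover have "\<Union>\<C> \<subseteq> base_ring" "\<exists>x\<in>\<Union>\<C>. x \<noteq> 0" "I \<subseteq> \<Union>\<C>"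
      using sub ne unfolding \<A>_def nonzero_ideal_iff by blast+
    ultimately have U: "nonzero_ideal (\<Union>\<C>)" by (simp add: nonzero_ideal_iff)
    have "ideal_inverse (\<Union>\<C>) \<noteq> base_ring"
    proof
      assume "ideal_inverse (\<Union>\<C>) = base_ring"
      then obtain F where F: "F \<subseteq> \<Union>\<C>" "finitely_generated F" "ideal_inverse F = base_ring"
        using H U unfolding H_domain_def by blast
      then obtain A where A: "finite A" "F = fract_span A" unfolding finitely_generated_def by blast
      then have "A \<subseteq> \<Union>\<C>" using F(1) fract.span_superset by blast
      then obtain X where X: "X \<in> \<C>" "A \<subseteq> X"
        using finite_subset_Union_chain[OF A(1) _ ne chain] by blast
      then have "F \<subseteq> X" unfolding A(2) using subm by (intro fract.span_minimal) auto
      then have "ideal_inverse X \<subseteq> base_ring" using ideal_inverse_antimono F(3) by blast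
      moreover have "base_ring \<subseteq> ideal_inverse X"
      proof (rule base_ring_subset_ideal_inverse)
        have "X \<in> \<A>" using X(1) sub by blast
        then show "X \<subseteq> base_ring" unfolding \<A>_def nonzero_ideal_def by simp
      qed
      ultimately have "ideal_inverse X = base_ring" by blast
      moreover have "X \<in> \<A>" using X(1) sub by blast
      ultimately show False unfolding \<A>_def by simp
    qed
    then show "\<Union>\<C> \<in> \<A>" using U \<open>I \<subseteq> \<Union>\<C>\<close> unfolding \<A>_def by blast
  qed
  then obtain P where P: "P \<in> \<A>" "\<And>X. X \<in> \<A> \<Longrightarrow> P \<subseteq> X \<Longrightarrow> X = P" by blast
  then have "maximal_conductor P" unfolding maximal_conductor_def \<A>_def by blast
  then show thesis using that P(1) unfolding \<A>_def by blast
qed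

text \<open>The intended case is \<open>P = conductor u\<close>. Elements of D outside
  \<open>P\<close> are the units of D at \<open>P\<close>, so \<open>pu\<close> says that
  \<open>1 / u\<close> is associated to the element \<open>p\<close> of \<open>P\<close>, and
  \<open>finite_order\<close> that each nonzero \<open>r\<close> becomes a unit after multiplication
  by some power of \<open>u\<close>.\<close>

locale conductor_valuation =
  fixes P :: "'a::idom fract set" and u p :: "'a fract"
  assumes zero_in: "0 \<in> P" and one_notin: "1 \<notin> P"
    and ideal: "\<And>r x. r \<in> base_ring \<Longrightarrow> x \<in> P \<Longrightarrow> r * x \<in> P"
    and P_subset: "P \<subseteq> base_ring"
    and prime: "\<And>a b. a \<in> base_ring \<Longrightarrow> b \<in> base_ring \<Longrightarrow> a * b \<in> P \<Longrightarrow> a \<in> P \<or> b \<in> P"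
    and p_in: "p \<in> P" and pu: "p * u \<in> base_ring - P"
    and finite_order: "\<And>r. r \<in> base_ring \<Longrightarrow> r \<noteq> 0 \<Longrightarrow> \<exists>n. r * u ^ n \<in> base_ring - P"
begin

abbreviation M where "M \<equiv> base_ring - P"

lemma M_mult: "a \<in> M \<Longrightarrow> b \<in> M \<Longrightarrow> a * b \<in> M"
  using prime base_ring_mult by blast

lemma M_1: "1 \<in> M"
  using one_notin by simp

lemma M_power: "a \<in> M \<Longrightarrow> a ^ n \<in> M"
proof (induction n)
  case 0
  show ?case using M_1 by simp
next
  case (Suc n)
  then show ?case using M_mult[of a "a ^ n"] by (simp only: power_Suc)
qed

lemma M_nonzero: "a \<in> M \<Longrightarrow> a \<noteq> 0"
  using zero_in by blast

lemma u_nonzero: "u \<noteq> 0"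
  using M_nonzero[OF pu] by auto

text \<open>Multiplying by a power of \<open>p\<close> gives \<open>f * (p * u) ^ Suc k\<close>,
  which is outside the prime \<open>P\<close>, whereas the same element has the factor
  \<open>p\<close> if \<open>g\<close> lies in D. This separates different orders.\<close>

lemma not_M_power:
  assumes "f \<in> M" "f * u ^ Suc k = g" shows "g \<notin> M"
proof
  assume "g \<in> M"
  have "f * (p * u) ^ Suc k = g * p ^ k * p"
    by (simp add: power_mult_distrib flip: assms(2))
  moreover have "g * p ^ k \<in> base_ring"
    using \<open>g \<in> M\<close> p_in P_subset by (auto intro: base_ring_mult base_ring_power)
  ultimately have "f * (p * u) ^ Suc k \<in> P"
    using ideal[OF _ p_in] by (simp only:)
  moreover have "f * (p * u) ^ Suc k \<in> M"
    using M_mult[OF assms(1) M_power[OF pu]] .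
  ultimately show False by blast
qed

text \<open>In the localization at \<open>P\<close> the element \<open>1 / u\<close> is a uniformizer.\<close>

definition has_order :: "int \<Rightarrow> 'a fract \<Rightarrow> bool" where
  "has_order n x \<longleftrightarrow> (\<exists>s t. s \<in> M \<and> t \<in> M \<and> x = s / t * inverse u powi n)"

definition ord :: "'a fract \<Rightarrow> int" where
  "ord x = (THE n. has_order n x)"

text \<open>Cancelling the smaller power of \<open>1 / u\<close> leaves an equation excluded by
  \<open>not_M_power\<close>. One strict inequality suffices, as \<open>ord_eqI\<close> uses it in
  both directions.\<close>

lemma has_order_unique_aux:
  assumes "has_order n x" "has_order m x" shows "\<not> n < m"
proof
  assume "n < m"
  define k where "k = nat (m - n - 1)"
  have m: "m = n + int (Suc k)" using \<open>n < m\<close> by (simp add: k_def)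
  obtain s t where st: "s \<in> M" "t \<in> M" "x = s / t * inverse u powi n"
    using assms(1) unfolding has_order_def by blast
  obtain s' t' where st': "s' \<in> M" "t' \<in> M" "x = s' / t' * inverse u powi m"
    using assms(2) unfolding has_order_def by blast
  have "inverse u powi m = inverse u powi n * inverse u ^ Suc k"
    using u_nonzero power_int_add[of "inverse u" n "int (Suc k)"]
    unfolding m power_int_of_nat by simp
  then have "s / t * inverse u powi n = (s' / t' * inverse u ^ Suc k) * inverse u powi n"
    using st(3) st'(3) by (simp only: mult_ac)
  moreover have "inverse u powi n \<noteq> 0" using u_nonzero by simp
  ultimately have "s / t = s' / t' * inverse u ^ Suc k"
    by (rule mult_right_cancel[THEN iffD1, rotated])
  then have "(s * t') * u ^ Suc k = s' * t"
    using u_nonzero M_nonzero[OF st(2)] M_nonzero[OF st'(2)] by (simp add: field_simps)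
  then have "s' * t \<notin> M" by (rule not_M_power[OF M_mult[OF st(1) st'(2)]])
  then show False using M_mult[OF st'(1) st(2)] by blast
qed

lemma ord_eqI:
  assumes "has_order n x" shows "ord x = n"
  unfolding ord_def
proof (rule the_equality)
  show "m = n" if "has_order m x" for m
    using has_order_unique_aux[OF assms that] has_order_unique_aux[OF that assms] by simp
qed (fact assms)

lemma has_order_mult:
  assumes "has_order n x" "has_order m y" shows "has_order (n + m) (x * y)"
proof -
  obtain s t where st: "s \<in> M" "t \<in> M" "x = s / t * inverse u powi n"
    using assms(1) unfolding has_order_def by blast
  obtain s' t' where st': "s' \<in> M" "t' \<in> M" "y = s' / t' * inverse u powi m"
    using assms(2) unfolding has_order_def by blast
  have "x * y = (s * s') / (t * t') * inverse u powi (n + m)"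
    using st(3) st'(3) u_nonzero by (simp add: power_int_add)
  then show ?thesis unfolding has_order_def
    using M_mult[OF st(1) st'(1)] M_mult[OF st(2) st'(2)] by (intro exI conjI)
qed

lemma has_order_inverse:
  assumes "has_order n x" shows "has_order (- n) (inverse x)"
proof -
  obtain s t where st: "s \<in> M" "t \<in> M" "x = s / t * inverse u powi n"
    using assms(1) unfolding has_order_def by blast
  have "inverse x = t / s * inverse u powi (- n)"
    using st(3) by (simp add: power_int_minus divide_inverse mult_ac)
  then show ?thesis unfolding has_order_def using st by blast
qed

lemma has_order_base_ring:
  assumes "r \<in> base_ring" "r \<noteq> 0"
  obtains n where "has_order (int n) r"
proof -
  obtain n where n: "r * u ^ n \<in> M" using finite_order assms by blast
  have "r = (r * u ^ n) / 1 * inverse u powi (int n)"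
    using u_nonzero by (simp add: power_inverse)
  then have "has_order (int n) r" unfolding has_order_def using n M_1 by blast
  then show thesis by (rule that)
qed

lemma has_order_ord: "x \<noteq> 0 \<Longrightarrow> has_order (ord x) x"
proof -
  assume "x \<noteq> 0"
  obtain c b where b: "b \<noteq> 0" "x = to_fract c / to_fract b" by (rule fract_cases)
  have "c \<noteq> 0" using b \<open>x \<noteq> 0\<close> by auto
  obtain n where n: "has_order (int n) (to_fract c)"
    using has_order_base_ring[of "to_fract c"] \<open>c \<noteq> 0\<close> by auto
  obtain m where m: "has_order (int m) (to_fract b)"
    using has_order_base_ring[of "to_fract b"] b(1) by auto
  have "has_order (int n + - int m) (to_fract c * inverse (to_fract b))"
    using has_order_mult[OF n has_order_inverse[OF m]] .
  then have "has_order (int n + - int m) x" using b(2) by (simp only: divide_inverse)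
  then show ?thesis using ord_eqI by simp
qed

lemma ord_mult: "x \<noteq> 0 \<Longrightarrow> y \<noteq> 0 \<Longrightarrow> ord (x * y) = ord x + ord y"
  by (intro ord_eqI has_order_mult has_order_ord)

lemma has_order_u: "has_order n (inverse u powi n)"
  unfolding has_order_def by (intro exI[of _ 1]) (simp add: M_1 one_notin)

lemma inverse_u_in_localization: "inverse u \<in> localization P"
proof -
  have "p \<noteq> 0" using M_nonzero[OF pu] by auto
  then have "inverse u = p / (p * u)" by (simp add: divide_inverse)
  then show ?thesis unfolding localization_def using pu p_in P_subset by blast
qed

lemma localization_mult:
  assumes "x \<in> localization P" "y \<in> localization P" shows "x * y \<in> localization P"
proof -
  obtain w t where wt: "w \<in> base_ring" "t \<in> M" "x = w / t"
    using assms(1) unfolding localization_def by blast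
  obtain w' t' where wt': "w' \<in> base_ring" "t' \<in> M" "y = w' / t'"
    using assms(2) unfolding localization_def by blast
  have "x * y = (w * w') / (t * t')" using wt(3) wt'(3) by simp
  then show ?thesis unfolding localization_def
    using base_ring_mult[OF wt(1) wt'(1)] M_mult[OF wt(2) wt'(2)] by blast
qed

lemma localization_add:
  assumes "x \<in> localization P" "y \<in> localization P" shows "x + y \<in> localization P"
proof -
  obtain w t where wt: "w \<in> base_ring" "t \<in> M" "x = w / t"
    using assms(1) unfolding localization_def by blast
  obtain w' t' where wt': "w' \<in> base_ring" "t' \<in> M" "y = w' / t'"
    using assms(2) unfolding localization_def by blast
  have "x + y = (w * t' + w' * t) / (t * t')"
    using wt(3) wt'(3) M_nonzero[OF wt(2)] M_nonzero[OF wt'(2)] by (simp add: add_frac_eq)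
  moreover have "w * t' + w' * t \<in> base_ring"
    using wt wt' by (blast intro: base_ring_add base_ring_mult)
  ultimately show ?thesis unfolding localization_def
    using M_mult[OF wt(2) wt'(2)] by blast
qed

lemma base_ring_subset_localization: "base_ring \<subseteq> localization P"
proof
  fix x :: "'a fract" assume "x \<in> base_ring"
  then show "x \<in> localization P" unfolding localization_def using M_1
    by (metis (mono_tags, lifting) div_by_1 mem_Collect_eq)
qed

lemma localization_power: "x \<in> localization P \<Longrightarrow> x ^ n \<in> localization P"
  using base_ring_subset_localization
  by (induction n) (auto intro: localization_mult)

text \<open>Elements of D have nonnegative order and denominators outside \<open>P\<close> have
  order 0. Conversely, an element of order \<open>n \<ge> 0\<close> is a fraction of units times the
  n-th power of \<open>1 / u\<close>, which lies in the localization.\<close>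

lemma localization_iff: "x \<in> localization P \<longleftrightarrow> x = 0 \<or> 0 \<le> ord x"
proof (cases "x = 0")
  case True
  then show ?thesis using base_ring_subset_localization by auto
next
  case False
  show ?thesis
  proof
    assume "x \<in> localization P"
    then obtain w t where wt: "w \<in> base_ring" "t \<in> M" "x = w / t"
      unfolding localization_def by blast
    obtain n where n: "has_order (int n) w"
      using has_order_base_ring[OF wt(1)] wt(3) False by auto
    have "inverse t = 1 / t * inverse u powi 0" by (simp add: divide_inverse)
    then have "has_order 0 (inverse t)" unfolding has_order_def using wt(2) M_1 by blast
    then have "has_order (int n + 0) (w * inverse t)" by (rule has_order_mult[OF n])
    then show "x = 0 \<or> 0 \<le> ord x" using ord_eqI wt(3) by (simp add: divide_inverse)
  next
    assume "x = 0 \<or> 0 \<le> ord x"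
    then have *: "inverse u powi ord x = inverse u ^ nat (ord x)"
      using False by (metis nat_0_le power_int_of_nat)
    obtain s t where st: "s \<in> M" "t \<in> M" "x = s / t * inverse u ^ nat (ord x)"
      using has_order_ord[OF False] unfolding has_order_def * by blast
    have "s / t \<in> localization P" unfolding localization_def using st by blast
    then have "s / t * inverse u ^ nat (ord x) \<in> localization P"
      using localization_mult localization_power[OF inverse_u_in_localization] by blast
    then show "x \<in> localization P" by (subst st(3))
  qed
qed

lemma discrete_valuation_ord: "discrete_valuation ord"
  unfolding discrete_valuation_def
proof (intro conjI allI impI)
  fix x y :: "'a fract"
  assume xy: "x \<noteq> 0 \<and> y \<noteq> 0 \<and> x + y \<noteq> 0"
  \<comment> \<open>Scaling by an element of order \<open>- n\<close> brings both summands into the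
    localization, so its closure under addition yields the ultrametric inequality.\<close>
  define n where "n = min (ord x) (ord y)"
  define z where "z = inverse u powi (- n)"
  have z: "z \<noteq> 0" "ord z = - n" using u_nonzero ord_eqI[OF has_order_u] by (auto simp: z_def)
  have "x * z \<in> localization P" "y * z \<in> localization P"
    using xy z by (auto simp: localization_iff ord_mult n_def)
  then have "(x + y) * z \<in> localization P"
    by (simp add: distrib_right localization_add)
  then show "min (ord x) (ord y) \<le> ord (x + y)"
    using xy z by (simp add: localization_iff ord_mult n_def)
next
  have "n \<in> ord ` (- {0})" for n
    using ord_eqI[OF has_order_u[of n]] u_nonzero
    by (intro image_eqI[of _ _ "inverse u powi n"]) auto
  then show "ord ` (- {0}) = UNIV" by blast
qed (simp add: ord_mult)

lemma discrete_valuation_ring_of_localization: "discrete_valuation_ring_of (localization P)"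
  unfolding discrete_valuation_ring_of_def
  using discrete_valuation_ord localization_iff by (intro exI[of _ ord]) blast

end

lemma conductor_valuation_maximal_conductor:
  fixes u :: "'a::idom fract"
  assumes cic: "completely_integrally_closed TYPE('a)"
    and P: "maximal_conductor (conductor u)" and u: "u \<notin> base_ring"
  obtains p where "conductor_valuation (conductor u) u p"
proof -
  have finite_order: "\<exists>n. r * u ^ n \<in> base_ring - conductor u" if r: "r \<in> base_ring" "r \<noteq> 0" for r
  proof (rule ccontr)
    assume *: "\<not> ?thesis"
    \<comment> \<open>An element of D that is not outside \<open>conductor u\<close> lies in it, so
      one more factor \<open>u\<close> still stays in D. Complete integral closedness would then put
      \<open>u\<close> into D.\<close>
    have "r * u ^ n \<in> base_ring" for n
    proof (induction n)
      case (Suc n)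
      then have "r * u ^ n \<in> conductor u" using * by blast
      then show ?case by (simp add: conductor_def mult_ac)
    qed (use r in simp)
    moreover obtain r' where "r = to_fract r'" using r(1) unfolding base_ring_def by blast
    ultimately show False using cic u r(2) unfolding completely_integrally_closed_def
      by (metis to_fract_0)
  qed
  obtain r where r: "r \<in> conductor u" "r \<noteq> 0"
    using nonzero_ideal_conductor[of u] unfolding nonzero_ideal_iff by blast
  \<comment> \<open>The witness \<open>p\<close> is the last \<open>r * u ^ m\<close> that still
    lies in \<open>conductor u\<close>; the least \<open>n\<close> is positive because
    \<open>r\<close> itself lies there.\<close>
  then obtain n where n: "r * u ^ n \<in> base_ring - conductor u"
    "\<And>m. m < n \<Longrightarrow> r * u ^ m \<notin> base_ring - conductor u"
    using exists_least_iff[of "\<lambda>n. r * u ^ n \<in> base_ring - conductor u"] finite_order[of r]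
    unfolding conductor_def by blast
  have "n \<noteq> 0" using n(1) r(1) by (cases n) auto
  then obtain m where m: "n = Suc m" by (cases n) auto
  have below: "k \<le> m \<Longrightarrow> r * u ^ k \<in> conductor u" for k
  proof (induction k)
    case (Suc k)
    then have "r * u ^ Suc k \<in> base_ring" by (simp add: conductor_def mult_ac)
    then show ?case using n(2)[of "Suc k"] Suc.prems m by simp
  qed (use r in simp)
  have "conductor_valuation (conductor u) u (r * u ^ m)"
  proof
    show "r * u ^ m \<in> conductor u" using below by simp
    show "r * u ^ m * u \<in> base_ring - conductor u" using n(1) m by (simp add: mult_ac)
    show "a \<in> conductor u \<or> b \<in> conductor u"
      if "a \<in> base_ring" "b \<in> base_ring" "a * b \<in> conductor u" for a b
      using maximal_conductor_prime[OF P that] .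
    show "a * x \<in> conductor u" if "a \<in> base_ring" "x \<in> conductor u" for a x
      using nonzero_ideal_conductor[of u] that fract_submodule_mult unfolding nonzero_ideal_iff by blast
  qed (use u finite_order in \<open>auto simp: conductor_def\<close>)
  then show thesis by (rule that)
qed

text \<open>If \<open>x \<in> P\<close> and \<open>y \<notin> P\<close>, then \<open>y / x\<close>
  is not in the localization at \<open>P\<close>. So finitely many \<open>y\<close>, not all in any
  single \<open>P\<close>, detect every \<open>P\<close> over \<open>x\<close>; it remains to find
  such \<open>y\<close> that are each bad at finitely many places only.\<close>

lemma finite_maximal_conductors:
  fixes x :: "'a::idom fract"
  assumes cic: "completely_integrally_closed TYPE('a)" and H: "H_domain TYPE('a)"
    and x: "x \<in> base_ring" "x \<noteq> 0"
  shows "finite {P. maximal_conductor P \<and> x \<in> P}"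
proof -
  have valuation: "\<exists>u p. P = conductor u \<and> conductor_valuation P u p"
    if P: "maximal_conductor P" for P :: "'a fract set"
    using maximal_conductor_eq_conductor[OF P] conductor_valuation_maximal_conductor[OF cic] P
    by metis
  have base: "r \<in> localization P" if "maximal_conductor P" "r \<in> base_ring"
    for r and P :: "'a fract set"
    using valuation[OF that(1)] conductor_valuation.base_ring_subset_localization that(2) by blast
  define bad where "bad y = {P. maximal_conductor P \<and> x \<in> P \<and> y / x \<notin> localization P}" for y
  \<comment> \<open>No maximal conductor contains \<open>N\<close>, so \<open>N\<close> has trivial inverse. A finitely generated
    subideal of \<open>N\<close> with trivial inverse then bounds the maximal conductors over \<open>x\<close>.\<close>
  define N where "N = {y \<in> base_ring. finite (bad y)}"
  have "fract_submodule N"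
  proof (rule fract_submoduleI)
    have "bad 0 = {}" using base[of _ 0] unfolding bad_def by auto
    then show "0 \<in> N" unfolding N_def by simp
  next
    fix y z assume yz: "y \<in> N" "z \<in> N"
    have "bad (y + z) \<subseteq> bad y \<union> bad z"
      using valuation conductor_valuation.localization_add
      unfolding bad_def add_divide_distrib by blast
    then have "finite (bad (y + z))" by (rule finite_subset) (use yz in \<open>simp add: N_def\<close>)
    then show "y + z \<in> N" using yz unfolding N_def by (auto intro: base_ring_add)
  next
    fix r y :: "'a fract" assume r: "r \<in> base_ring" and y: "y \<in> N"
    have "bad (r * y) \<subseteq> bad y"
      using valuation conductor_valuation.localization_mult base[OF _ r]
      unfolding bad_def times_divide_eq_right[symmetric] by blast
    then have "finite (bad (r * y))" by (rule finite_subset) (use y in \<open>simp add: N_def\<close>)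
    then show "r * y \<in> N" using r y unfolding N_def by (auto intro: base_ring_mult)
  qed
  moreover have "x \<in> N"
  proof -
    have "bad x = {}" using base[of _ 1] x(2) unfolding bad_def by auto
    then show ?thesis unfolding N_def using x by simp
  qed
  ultimately have N: "nonzero_ideal N"
    using x(2) unfolding nonzero_ideal_iff N_def by blast
  have "ideal_inverse N = base_ring"
  proof (rule ccontr)
    assume "ideal_inverse N \<noteq> base_ring"
    then obtain P where P: "maximal_conductor P" "N \<subseteq> P"
      using exists_maximal_conductor[OF H N] by blast
    then obtain u p where u: "P = conductor u" "conductor_valuation P u p" using valuation by blast
    obtain n where n: "x * u ^ n \<in> base_ring - P"
      using conductor_valuation.finite_order[OF u(2) x] by blast
    \<comment> \<open>Another maximal conductor \<open>Q\<close> omits some \<open>s\<close> of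
      \<open>P = conductor u\<close>, so \<open>u = (s * u) / s\<close> is integral at
      \<open>Q\<close>, and so is the quotient \<open>u ^ n\<close>.\<close>
    have "bad (x * u ^ n) \<subseteq> {P}"
    proof (rule subsetI, rule ccontr)
      fix Q assume Q: "Q \<in> bad (x * u ^ n)" "Q \<notin> {P}"
      then have Qmax: "maximal_conductor Q" unfolding bad_def by blast
      then have "\<not> P \<subseteq> Q" using P(1) Q(2) unfolding maximal_conductor_def by blast
      then obtain s where s: "s \<in> P" "s \<notin> Q" by blast
      obtain w q where Qval: "conductor_valuation Q w q" using valuation Qmax by blast
      then have "s \<noteq> 0" using s(2) conductor_valuation.zero_in by blast
      then have "u = (s * u) / s" by simp
      then have "u \<in> localization Q"
        using s u(1) unfolding localization_def conductor_def by blast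
      then have "u ^ n \<in> localization Q" by (rule conductor_valuation.localization_power[OF Qval])
      then show False using Q(1) x(2) unfolding bad_def by simp
    qed
    then have "finite (bad (x * u ^ n))" by (rule finite_subset) simp
    then show False using n P(2) unfolding N_def by blast
  qed
  then obtain F where F: "F \<subseteq> N" "finitely_generated F" "ideal_inverse F = base_ring"
    using H N unfolding H_domain_def by blast
  then obtain A where A: "finite A" "F = fract_span A" unfolding finitely_generated_def by blast
  have AN: "A \<subseteq> N" using A(2) F(1) fract.span_superset by blast
  have "{P. maximal_conductor P \<and> x \<in> P} \<subseteq> (\<Union>y\<in>A. bad y)"
  proof (rule subsetI, rule ccontr)
    fix P assume "P \<in> {P. maximal_conductor P \<and> x \<in> P}" and notbad: "P \<notin> (\<Union>y\<in>A. bad y)"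
    then have P: "maximal_conductor P" "x \<in> P" by auto
    then obtain u p where val: "conductor_valuation P u p" using valuation by blast
    have "A \<subseteq> P"
    proof
      fix y assume "y \<in> A"
      then have "y / x \<in> localization P" using notbad P unfolding bad_def by blast
      then obtain w t where wt: "w \<in> base_ring" "t \<in> base_ring - P" "y / x = w / t"
        unfolding localization_def by blast
      have "t \<noteq> 0" using wt(2) conductor_valuation.zero_in[OF val] by blast
      then have "t * y = w * x" using wt(3) x(2) by (simp add: field_simps)
      then have "t * y \<in> P" using conductor_valuation.ideal[OF val wt(1) P(2)] by simp
      moreover have "y \<in> base_ring" using AN \<open>y \<in> A\<close> unfolding N_def by blast
      ultimately show "y \<in> P" using conductor_valuation.prime[OF val, of t y] wt(2) by blast
    qed
    then have "F \<subseteq> P" unfolding A(2) using P(1)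
      unfolding maximal_conductor_def nonzero_ideal_def by (intro fract.span_minimal) auto
    then have "ideal_inverse P \<subseteq> base_ring" using ideal_inverse_antimono F(3) by blast
    moreover have "base_ring \<subseteq> ideal_inverse P"
      using P(1) base_ring_subset_ideal_inverse unfolding maximal_conductor_def nonzero_ideal_def by blast
    ultimately show False using P(1) unfolding maximal_conductor_def by blast
  qed
  moreover have "finite (\<Union>y\<in>A. bad y)" using A(1) AN unfolding N_def by blast
  ultimately show ?thesis by (rule finite_subset)
qed

theorem krull_domain_if_completely_integrally_closed_H_domain:
  assumes cic: "completely_integrally_closed TYPE('a::idom)" and H: "H_domain TYPE('a)"
  shows "krull_domain TYPE('a)"
proof -
  define \<V> :: "'a fract set set" where "\<V> = localization ` {P. maximal_conductor P}"
  have valuation: "\<exists>u p. conductor_valuation P u p"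
    if P: "maximal_conductor P" for P :: "'a fract set"
    using maximal_conductor_eq_conductor[OF P] conductor_valuation_maximal_conductor[OF cic] P
    by metis
  have "\<forall>V\<in>\<V>. discrete_valuation_ring_of V"
    using valuation conductor_valuation.discrete_valuation_ring_of_localization
    unfolding \<V>_def by blast
  moreover have "base_ring \<subseteq> \<Inter>\<V>"
    using valuation conductor_valuation.base_ring_subset_localization unfolding \<V>_def by blast
  \<comment> \<open>If \<open>x\<close> is outside D, its conductor lies in some \<open>P\<close>.
    But a denominator of \<open>x\<close> outside \<open>P\<close> would belong to the
    conductor.\<close>
  moreover have "x \<in> base_ring" if x: "x \<in> \<Inter>\<V>" for x
  proof (rule ccontr)
    assume "x \<notin> base_ring"
    then obtain P where P: "maximal_conductor P" "conductor x \<subseteq> P"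
      using exists_maximal_conductor[OF H nonzero_ideal_conductor ideal_inverse_conductor] by blast
    then have "x \<in> localization P" using x unfolding \<V>_def by blast
    then obtain w t where wt: "w \<in> base_ring" "t \<in> base_ring - P" "x = w / t"
      unfolding localization_def by blast
    obtain u p where "conductor_valuation P u p" using valuation P(1) by blast
    then have "t \<noteq> 0" using wt(2) conductor_valuation.zero_in by blast
    then have "t \<in> conductor x" using wt by (simp add: conductor_def)
    then show False using wt(2) P(2) by blast
  qed
  moreover have "finite {V \<in> \<V>. inverse x \<notin> V}" if x: "x \<in> base_ring" "x \<noteq> 0" for x
  proof -
    have "{V \<in> \<V>. inverse x \<notin> V} \<subseteq> localization ` {P. maximal_conductor P \<and> x \<in> P}"
    proof
      fix V assume "V \<in> {V \<in> \<V>. inverse x \<notin> V}"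
      then obtain P where P: "maximal_conductor P" "V = localization P" "inverse x \<notin> localization P"
        unfolding \<V>_def by blast
      have "x \<in> P"
      proof (rule ccontr)
        assume "x \<notin> P"
        moreover have "inverse x = 1 / x" by (simp add: divide_inverse)
        ultimately show False using P(3) x(1) base_ring_1 unfolding localization_def by blast
      qed
      then show "V \<in> localization ` {P. maximal_conductor P \<and> x \<in> P}" using P by blast
    qed
    then show ?thesis using finite_maximal_conductors[OF cic H x] finite_surj by blast
  qed
  ultimately show ?thesis unfolding krull_domain_def by (intro exI[of _ \<V>]) blast
qed

section \<open>Power series over a Krull domain\<close>

lemma discrete_valuation_1:
  assumes "discrete_valuation v" shows "v 1 = 0"
proof -
  have "v (1 * 1) = v 1 + v 1" using assms unfolding discrete_valuation_def by (metis one_neq_zero)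
  then show ?thesis by simp
qed

lemma discrete_valuation_power:
  assumes v: "discrete_valuation v" and "x \<noteq> 0"
  shows "v (x ^ n) = int n * v x"
proof (induction n)
  case 0
  show ?case using discrete_valuation_1[OF v] by simp
next
  case (Suc n)
  then show ?case using v \<open>x \<noteq> 0\<close> unfolding discrete_valuation_def by (simp add: distrib_right)
qed

theorem completely_integrally_closed_if_krull_domain:
  assumes "krull_domain TYPE('a::idom)"
  shows "completely_integrally_closed TYPE('a)"
  unfolding completely_integrally_closed_def
proof (intro allI impI)
  fix x :: "'a fract" and r :: 'a
  assume *: "r \<noteq> 0 \<and> (\<forall>n\<ge>1. to_fract r * x ^ n \<in> base_ring)"
  obtain \<V> :: "'a fract set set" where \<V>: "\<forall>V\<in>\<V>. discrete_valuation_ring_of V"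
    "base_ring = \<Inter>\<V>"
    using assms unfolding krull_domain_def by (elim exE conjE)
  have "x \<in> V" if V: "V \<in> \<V>" for V
  proof -
    obtain v where v: "discrete_valuation v" "V = {x. x = 0 \<or> 0 \<le> v x}"
      using bspec[OF \<V>(1) V] unfolding discrete_valuation_ring_of_def by (elim exE conjE)
    show "x \<in> V"
    proof (rule ccontr)
      assume "x \<notin> V"
      then have x: "x \<noteq> 0" "v x \<le> - 1" using v(2) by auto
      \<comment> \<open>This exponent exceeds \<open>v (to_fract r)\<close>, so a negative value of
        \<open>x\<close> outweighs the denominator.\<close>
      define n where "n = Suc (nat (v (to_fract r)))"
      have "n \<ge> 1" by (simp add: n_def)
      then have "to_fract r * x ^ n \<in> base_ring" using * by blast
      then have "to_fract r * x ^ n \<in> V" using V \<V>(2) by blast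
      then have "0 \<le> v (to_fract r * x ^ n)" using * x v(2) by simp
      also have "\<dots> = v (to_fract r) + int n * v x"
        using v(1) * x discrete_valuation_power[OF v(1) x(1)] unfolding discrete_valuation_def by simp
      also have "\<dots> \<le> v (to_fract r) + int n * (- 1)"
        using x(2) by (intro add_left_mono mult_left_mono) auto
      finally show False unfolding n_def by (simp split: if_splits)
    qed
  qed
  then show "x \<in> base_ring" using \<V>(2) by blast
qed

section \<open>Submodules of K[[X]] generated over S[[X]]\<close>

inductive_set span_over :: "'k::field set \<Rightarrow> 'k fps set \<Rightarrow> 'k fps set" for S J where
  zero: "0 \<in> span_over S J"
| add: "x \<in> span_over S J \<Longrightarrow> r \<in> fps_over S \<Longrightarrow> j \<in> J \<Longrightarrow> x + r * j \<in> span_over S J"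

lemma span_over_add:
  assumes x: "x \<in> span_over S J"
  shows "y \<in> span_over S J \<Longrightarrow> x + y \<in> span_over S J"
proof (induction y rule: span_over.induct)
  case (add y r j)
  then show ?case using span_over.add[of "x + y" S J r j] by (simp add: add.assoc)
qed (simp add: x)

lemma span_over_mult:
  assumes S: "is_subring S" and "f \<in> fps_over S"
  shows "x \<in> span_over S J \<Longrightarrow> f * x \<in> span_over S J"
proof (induction x rule: span_over.induct)
  case (add x r j)
  then show ?case
    using span_over.add[OF add.IH fps_over_mult[OF S \<open>f \<in> fps_over S\<close> add.hyps(2)] add.hyps(3)]
    by (simp add: distrib_left mult.assoc)
qed (simp add: span_over.zero)

lemma span_over_superset:
  assumes S: "is_subring S" and "j \<in> J" shows "j \<in> span_over S J"
  using span_over.add[OF span_over.zero fps_over_X_power[OF S, of 0] \<open>j \<in> J\<close>] by simp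

lemma span_over_mono: "I \<subseteq> J \<Longrightarrow> span_over S I \<subseteq> span_over S J"
proof
  fix x assume "I \<subseteq> J" "x \<in> span_over S I"
  from this(2,1) show "x \<in> span_over S J"
    by (induction x rule: span_over.induct) (auto intro: span_over.intros)
qed

lemma span_over_subset_fps_over:
  assumes S: "is_subring S" and "J \<subseteq> fps_over S" shows "span_over S J \<subseteq> fps_over S"
proof
  fix x assume "x \<in> span_over S J"
  then show "x \<in> fps_over S"
    using assms by (induction x rule: span_over.induct) (auto intro: fps_over_0 fps_over_add fps_over_mult)
qed

lemma span_over_finite_support:
  "x \<in> span_over S J \<Longrightarrow> \<exists>F\<subseteq>J. finite F \<and> x \<in> span_over S F"
proof (induction x rule: span_over.induct)
  case zero
  then show ?case by (intro exI[of _ "{}"]) (simp add: span_over.zero)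
next
  case (add x r j)
  then obtain F where F: "F \<subseteq> J" "finite F" "x \<in> span_over S F" by blast
  then have "x + r * j \<in> span_over S (insert j F)"
    using span_over_mono[of F "insert j F" S] add.hyps by (intro span_over.add) auto
  then show ?case using F add.hyps(3) by (intro exI[of _ "insert j F"]) auto
qed

section \<open>Ideals of V[[X]] over a discrete valuation ring V\<close>

lemma discrete_valuation_uminus:
  assumes "discrete_valuation v" "x \<noteq> 0" shows "v (- x) = v x"
proof -
  have mult: "v (x * y) = v x + v y" if "x \<noteq> 0" "y \<noteq> 0" for x y
    using assms that unfolding discrete_valuation_def by blast
  have "v (- 1) + v (- 1) = 0"
    using mult[of "- 1" "- 1"] discrete_valuation_1[OF assms(1)] by simp
  then show ?thesis using mult[of "- 1" x] assms(2) by simp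
qed

lemma is_subring_discrete_valuation_ring:
  assumes "discrete_valuation v"
  shows "is_subring {x. x = 0 \<or> 0 \<le> v x}"
  unfolding is_subring_def
proof (intro conjI ballI)
  fix x y assume xy: "x \<in> {x. x = 0 \<or> 0 \<le> v x}" "y \<in> {x. x = 0 \<or> 0 \<le> v x}"
  have "0 \<le> v (x + y)" if "x \<noteq> 0" "y \<noteq> 0" "x + y \<noteq> 0"
  proof -
    have "min (v x) (v y) \<le> v (x + y)"
      using assms that unfolding discrete_valuation_def by blast
    then show ?thesis using xy that by auto
  qed
  then show "x + y \<in> {x. x = 0 \<or> 0 \<le> v x}" using xy by fastforce
  show "x * y \<in> {x. x = 0 \<or> 0 \<le> v x}"
    using assms xy unfolding discrete_valuation_def by (cases "x = 0 \<or> y = 0") auto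
next
  fix x assume "x \<in> {x. x = 0 \<or> 0 \<le> v x}"
  then show "- x \<in> {x. x = 0 \<or> 0 \<le> v x}"
    using discrete_valuation_uminus[OF assms, of x] by (cases "x = 0") auto
qed (use discrete_valuation_1[OF assms] in auto)

text \<open>
  After inverting \<open>X\<close>, the span becomes a principal ideal, generated by an element whose lowest
  coefficient has minimal valuation: the coefficients of the quotient \<open>h\<close> are lowest coefficients
  of elements of the span, divided by that of \<open>f\<close>.
\<close>

lemma span_over_discrete_valuation_ring_principal:
  fixes f :: "'k::field fps"
  assumes v: "discrete_valuation v" and V: "V = {x. x = 0 \<or> 0 \<le> v x}"
    and f: "f \<in> span_over V J" "f \<noteq> 0"
    and min: "\<And>g. g \<in> span_over V J \<Longrightarrow> g \<noteq> 0 \<Longrightarrow> v (f $ subdegree f) \<le> v (g $ subdegree g)"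
    and g: "g \<in> span_over V J"
  shows "\<exists>h\<in>fps_over V. fps_X ^ subdegree f * g = h * f"
proof -
  have sub: "is_subring V" unfolding V by (rule is_subring_discrete_valuation_ring[OF v])
  define k where "k = subdegree f"
  define f' where "f' = fps_shift k f"
  have ff': "f = fps_X ^ k * f'"
    using subdegree_decompose[of f] by (simp add: f'_def k_def mult.commute)
  have f'0: "f' $ 0 = f $ k" "f $ k \<noteq> 0" using f(2) by (simp_all add: f'_def k_def)
  \<comment> \<open>The series \<open>f'\<close> is a unit of K[[X]], so the quotient exists there;
    only its coefficients remain to be checked.\<close>
  define h where "h = g * inverse f'"
  have hf': "h * f' = g" using f'0 by (simp add: h_def mult.assoc inverse_mult_eq_1)
  then have hf: "fps_X ^ k * g = h * f" unfolding ff' by (simp add: mult_ac)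
  have "h $ n \<in> V" for n
  proof (induction n rule: less_induct)
    case (less n)
    show ?case
    proof (cases "h $ n = 0")
      case False
      define d where "d = fps_cutoff n h"
      define h' where "h' = fps_shift n h"
      have d: "- d \<in> fps_over V"
        using less sub by (intro fps_over_uminus) (auto simp: d_def fps_over_def is_subring_def)
      \<comment> \<open>By induction the part \<open>d\<close> of \<open>h\<close> below degree
        \<open>n\<close> is over V, so subtracting \<open>d * f\<close> stays in the span and
        exposes the lowest coefficient \<open>h $ n * f $ k\<close>. Minimality of \<open>f\<close>
        then bounds the value of \<open>h $ n\<close> from below by 0.\<close>
      define g' where "g' = fps_X ^ k * g + (- d) * f"
      have "g' = (h - d) * f" unfolding g'_def hf by (simp add: algebra_simps)
      moreover have "h - d = fps_X ^ n * h'"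
        unfolding d_def h'_def by (simp only: diff_eq_eq fps_shift_cutoff')
      ultimately have g': "g' = (fps_X ^ n * h') * f" by simp
      have h'0: "h' $ 0 = h $ n" by (simp add: h'_def)
      then have "h' \<noteq> 0" "subdegree h' = 0" using False by auto
      then have "g' \<noteq> 0" "subdegree g' = n + k"
        using g' f(2) by (auto simp: k_def fps_X_power_subdegree)
      moreover have "g' \<in> span_over V J"
        unfolding g'_def by (intro span_over_add span_over_mult fps_over_X_power sub d f(1) g)
      moreover have "g' $ (n + k) = h $ n * f $ k"
      proof -
        have "g' = fps_X ^ (n + k) * (h' * f')" unfolding g' ff' by (simp add: power_add mult_ac)
        then have "g' $ (n + k) = (h' * f') $ 0" by (simp add: fps_X_power_mult_nth)
        then show ?thesis by (simp add: f'0 h'0)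
      qed
      ultimately have "v (f $ k) \<le> v (h $ n * f $ k)" using min[of g'] by (simp add: k_def)
      moreover have "v (h $ n * f $ k) = v (h $ n) + v (f $ k)"
        using v False f'0(2) unfolding discrete_valuation_def by blast
      ultimately show ?thesis by (simp add: V)
    qed (simp add: V)
  qed
  then have "h \<in> fps_over V" by (simp add: fps_over_def)
  with hf show ?thesis unfolding k_def by blast
qed

text \<open>Values of lowest coefficients are nonnegative integers on the span, so a minimal one is
  attained by some \<open>f\<close>. This \<open>f\<close> involves finitely many members of
  \<open>J\<close>, and \<open>N\<close> is its order.\<close>

lemma fps_over_discrete_valuation_ring_finite:
  fixes J :: "'k::field fps set"
  assumes V: "discrete_valuation_ring_of V" and J: "J \<subseteq> fps_over V" "j \<in> J" "j \<noteq> 0"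
  shows "\<exists>F N. F \<subseteq> J \<and> finite F \<and> (\<forall>g\<in>J. fps_X ^ N * g \<in> span_over V F)"
proof -
  obtain v where v: "discrete_valuation v" and Vv: "V = {x. x = 0 \<or> 0 \<le> v x}"
    using V unfolding discrete_valuation_ring_of_def by blast
  have sub: "is_subring V" unfolding Vv by (rule is_subring_discrete_valuation_ring[OF v])
  have nonneg: "0 \<le> v (g $ subdegree g)" if "g \<in> span_over V J" "g \<noteq> 0" for g
  proof -
    have "g \<in> fps_over V" using that span_over_subset_fps_over[OF sub J(1)] by blast
    then have "g $ subdegree g \<in> V" by (simp add: fps_over_def)
    then show ?thesis using that(2) by (simp add: Vv)
  qed
  obtain f where f: "f \<in> span_over V J" "f \<noteq> 0"
    "\<And>g. g \<in> span_over V J \<Longrightarrow> g \<noteq> 0 \<Longrightarrow> nat (v (f $ subdegree f)) \<le> nat (v (g $ subdegree g))"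
    using ex_has_least_nat[of "\<lambda>g. g \<in> span_over V J \<and> g \<noteq> 0" j "\<lambda>g. nat (v (g $ subdegree g))"]
      span_over_superset[OF sub J(2)] J(3) by blast
  obtain F where F: "F \<subseteq> J" "finite F" "f \<in> span_over V F"
    using span_over_finite_support[OF f(1)] by blast
  have "fps_X ^ subdegree f * g \<in> span_over V F" if "g \<in> J" for g
  proof -
    have "\<exists>h\<in>fps_over V. fps_X ^ subdegree f * g = h * f"
    proof (rule span_over_discrete_valuation_ring_principal[OF v Vv f(1,2)])
      show "v (f $ subdegree f) \<le> v (g $ subdegree g)" if "g \<in> span_over V J" "g \<noteq> 0" for g
        using f(3)[OF that] nonneg[OF that] nonneg[OF f(1,2)] by simp
    qed (rule span_over_superset[OF sub \<open>g \<in> J\<close>])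
    then show ?thesis using span_over_mult[OF sub _ F(3)] by auto
  qed
  with F show ?thesis by blast
qed

text \<open>A unit as lowest coefficient has the least possible value, so \<open>f\<close> alone
  generates up to a power of X. This handles all but finitely many V.\<close>

lemma fps_over_discrete_valuation_ring_unit:
  fixes J :: "'k::field fps set"
  assumes V: "discrete_valuation_ring_of V" and J: "J \<subseteq> fps_over V" "f \<in> J" "f \<noteq> 0"
    and unit: "inverse (f $ subdegree f) \<in> V" and "g \<in> J"
  shows "fps_X ^ subdegree f * g \<in> span_over V {f}"
proof -
  obtain v where v: "discrete_valuation v" and Vv: "V = {x. x = 0 \<or> 0 \<le> v x}"
    using V unfolding discrete_valuation_ring_of_def by blast
  have sub: "is_subring V" unfolding Vv by (rule is_subring_discrete_valuation_ring[OF v])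
  let ?c = "f $ subdegree f"
  have "?c \<noteq> 0" using J(3) by simp
  then have "v (inverse ?c * ?c) = v (inverse ?c) + v ?c"
    using v unfolding discrete_valuation_def by (meson inverse_nonzero_iff_nonzero)
  then have "v ?c \<le> 0"
    using unit \<open>?c \<noteq> 0\<close> discrete_valuation_1[OF v] unfolding Vv by auto
  have "\<exists>h\<in>fps_over V. fps_X ^ subdegree f * g = h * f"
  proof (rule span_over_discrete_valuation_ring_principal[OF v Vv])
    show "v ?c \<le> v (g $ subdegree g)" if "g \<in> span_over V J" "g \<noteq> 0" for g
    proof -
      have "g \<in> fps_over V" using that span_over_subset_fps_over[OF sub J(1)] by blast
      then have "g $ subdegree g \<in> V" by (simp add: fps_over_def)
      then have "0 \<le> v (g $ subdegree g)" using that(2) by (simp add: Vv)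
      then show ?thesis using \<open>v ?c \<le> 0\<close> by simp
    qed
  qed (use J \<open>g \<in> J\<close> span_over_superset[OF sub] in auto)
  then show ?thesis using span_over_mult[OF sub _ span_over_superset[OF sub, of f "{f}"]] by auto
qed

theorem H_domain_fps:
  assumes "krull_domain TYPE('a::idom)"
  shows "H_domain TYPE('a fps)"
  unfolding H_domain_def
proof (intro allI impI)
  fix I :: "'a fps fract set"
  assume I: "nonzero_ideal I \<and> ideal_inverse I = base_ring"
  obtain \<V> :: "'a fract set set" where dvr: "\<forall>V\<in>\<V>. discrete_valuation_ring_of V"
    and base: "base_ring = \<Inter>\<V>" and fin: "\<forall>x\<in>base_ring. x \<noteq> 0 \<longrightarrow> finite {V\<in>\<V>. inverse x \<notin> V}"
    using assms unfolding krull_domain_def by (elim exE conjE)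
  define J where "J = {j. to_fract j \<in> I}"
  have IJ: "I = to_fract ` J"
    using I unfolding J_def nonzero_ideal_def base_ring_def by blast
  obtain j0 where "j0 \<in> J" "j0 \<noteq> 0"
    using I unfolding nonzero_ideal_iff IJ by auto
  \<comment> \<open>Least order makes \<open>f\<close> divide every member of \<open>J\<close> in
    K[[X]].\<close>
  then obtain f where f: "f \<in> J" "f \<noteq> 0" "\<And>j. j \<in> J \<Longrightarrow> j \<noteq> 0 \<Longrightarrow> subdegree f \<le> subdegree j"
    using ex_has_least_nat[of "\<lambda>j. j \<in> J \<and> j \<noteq> 0" j0 subdegree] by blast
  \<comment> \<open>Finite character for the lowest coefficient of \<open>f\<close>: outside
    \<open>\<B>\<close> it is a unit and \<open>f\<close> suffices, while each V in
    \<open>\<B>\<close> contributes finitely many further generators.\<close>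
  define \<B> where "\<B> = {V\<in>\<V>. inverse (to_fract (f $ subdegree f)) \<notin> V}"
  have "finite \<B>" using fin f(2) unfolding \<B>_def by simp
  have J_over: "fps_to_fract ` J \<subseteq> fps_over V" if "V \<in> \<V>" for V
    using that base base_ring_to_fract unfolding fps_over_def by fastforce
  have "\<forall>V\<in>\<B>. \<exists>F. F \<subseteq> J \<and> finite F \<and>
      (\<exists>N. \<forall>j\<in>J. fps_X ^ N * fps_to_fract j \<in> span_over V (fps_to_fract ` F))"
  proof
    fix V assume "V \<in> \<B>"
    then have V: "V \<in> \<V>" unfolding \<B>_def by blast
    obtain F N where F: "F \<subseteq> fps_to_fract ` J" "finite F"
      "\<forall>g\<in>fps_to_fract ` J. fps_X ^ N * g \<in> span_over V F"
      using fps_over_discrete_valuation_ring_finite[OF bspec[OF dvr V] J_over[OF V] imageI[OF f(1)]] f(2)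
      by auto
    obtain F' where "F' \<subseteq> J" "finite F'" "F = fps_to_fract ` F'"
      using finite_subset_image[OF F(2,1)] by blast
    with F(3) show "\<exists>F. F \<subseteq> J \<and> finite F \<and>
      (\<exists>N. \<forall>j\<in>J. fps_X ^ N * fps_to_fract j \<in> span_over V (fps_to_fract ` F))" by blast
  qed
  then obtain G where G: "\<And>V. V \<in> \<B> \<Longrightarrow> G V \<subseteq> J" "\<And>V. V \<in> \<B> \<Longrightarrow> finite (G V)"
    "\<And>V. V \<in> \<B> \<Longrightarrow> \<exists>N. \<forall>j\<in>J. fps_X ^ N * fps_to_fract j \<in> span_over V (fps_to_fract ` G V)"
    by (metis bchoice)
  define A where "A = insert f (\<Union>V\<in>\<B>. G V)"
  have A: "finite A" "A \<subseteq> J" "f \<in> A" using G f(1) \<open>finite \<B>\<close> unfolding A_def by auto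
  have gen: "\<exists>N. \<forall>j\<in>J. fps_X ^ N * fps_to_fract j \<in> span_over V (fps_to_fract ` A)" if V: "V \<in> \<V>" for V
  proof (cases "V \<in> \<B>")
    case True
    then have "fps_to_fract ` G V \<subseteq> fps_to_fract ` A" unfolding A_def by blast
    then show ?thesis using G(3)[OF True] span_over_mono by blast
  next
    case False
    then have "inverse (fps_to_fract f $ subdegree (fps_to_fract f)) \<in> V"
      using V unfolding \<B>_def by simp
    then have "fps_X ^ subdegree f * fps_to_fract j \<in> span_over V {fps_to_fract f}" if "j \<in> J" for j
      using fps_over_discrete_valuation_ring_unit[OF bspec[OF dvr V] J_over[OF V] imageI[OF f(1)] _ _
          imageI[OF that]] f(2) by simp
    then show ?thesis using span_over_mono[of "{fps_to_fract f}" "fps_to_fract ` A" V] A(3) by blast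
  qed
  define F where "F = fract_span (to_fract ` A)"
  have "F \<subseteq> I"
    unfolding F_def using I A(2) unfolding nonzero_ideal_def IJ by (intro fract.span_minimal) auto
  moreover have F: "nonzero_ideal F"
    unfolding nonzero_ideal_iff
  proof (intro conjI bexI[of _ "to_fract f"])
    show "to_fract f \<in> F" unfolding F_def using A(3) by (intro fract.span_base) simp
    show "F \<subseteq> base_ring" using \<open>F \<subseteq> I\<close> I unfolding nonzero_ideal_def by blast
  qed (use f(2) in \<open>simp_all add: F_def fract.subspace_span\<close>)
  moreover have "finitely_generated F"
    unfolding finitely_generated_def F_def using A(1) by (intro exI[of _ "to_fract ` A"]) simp
  moreover have "ideal_inverse F \<subseteq> base_ring"
  proof
    fix x assume x: "x \<in> ideal_inverse F"
    obtain g h where h: "h \<noteq> 0" "x = to_fract g / to_fract h" by (rule fract_cases)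
    have "h dvd g * a" if "a \<in> A" for a
    proof -
      have "to_fract a \<in> F" unfolding F_def using that by (intro fract.span_base) simp
      then have "to_fract (g * a) / to_fract h \<in> base_ring"
        using x unfolding ideal_inverse_def h(2) by auto
      then show ?thesis using to_fract_divide_in_base_ring_iff[OF h(1)] by blast
    qed
    then have "\<forall>a\<in>A. \<exists>w. g * a = h * w" by (auto elim: dvdE)
    then obtain w where w: "\<And>a. a \<in> A \<Longrightarrow> g * a = h * w a" by metis
    have "h dvd g * j" if j: "j \<in> J" for j
    proof (cases "j = 0")
      case False
      have "fps_to_fract f dvd fps_to_fract j"
        using f(3)[OF j False] f(2) False by (subst fps_dvd_iff) auto
      then obtain e where e: "fps_to_fract j = fps_to_fract f * e" ..
      \<comment> \<open>This is \<open>g j / h\<close> as a series over K, since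
        \<open>h * w f = g * f\<close>. It remains to show that its coefficients lie in every
        V.\<close>
      define z where "z = fps_to_fract (w f) * e"
      have hz: "fps_to_fract h * z = fps_to_fract (g * j)"
        using w[OF A(3)] unfolding z_def fps_to_fract_mult e
        by (metis fps_to_fract_mult mult.assoc)
      have "z \<in> fps_over V" if V: "V \<in> \<V>" for V
      proof -
        have sub: "is_subring V"
          using bspec[OF dvr V] is_subring_discrete_valuation_ring
          unfolding discrete_valuation_ring_of_def by blast
        \<comment> \<open>Divisibility by \<open>h\<close> after multiplication by \<open>g\<close>
          is known on \<open>A\<close> and extends to its span over V[[X]].\<close>
        have quot: "\<exists>y\<in>fps_over V. fps_to_fract g * x = fps_to_fract h * y"
          if "x \<in> span_over V (fps_to_fract ` A)" for x
          using that
        proof (induction x rule: span_over.induct)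
          case zero
          show ?case using fps_over_0[OF sub] by (intro bexI[of _ 0]) auto
        next
          case (add x r y)
          then obtain x' a where x': "x' \<in> fps_over V" "fps_to_fract g * x = fps_to_fract h * x'"
            and a: "a \<in> A" "y = fps_to_fract a" by blast
          have "fps_to_fract (w a) \<in> fps_over V"
            using V base fps_to_fract_in_fps_over_base_ring[of "w a"] unfolding fps_over_def by blast
          then have "x' + r * fps_to_fract (w a) \<in> fps_over V"
            using fps_over_add[OF sub x'(1)] fps_over_mult[OF sub add.hyps(2)] by blast
          moreover have "fps_to_fract g * y = fps_to_fract h * fps_to_fract (w a)"
            unfolding a(2) using w[OF a(1)] by (simp flip: fps_to_fract_mult)
          then have "fps_to_fract g * (x + r * y) = fps_to_fract h * (x' + r * fps_to_fract (w a))"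
            using x'(2) by (simp add: distrib_left mult.left_commute)
          ultimately show ?case by blast
        qed
        obtain N where "fps_X ^ N * fps_to_fract j \<in> span_over V (fps_to_fract ` A)"
          using gen[OF V] j by blast
        from quot[OF this] obtain y where y: "y \<in> fps_over V"
          "fps_to_fract g * (fps_X ^ N * fps_to_fract j) = fps_to_fract h * y" by blast
        \<comment> \<open>The factor \<open>fps_X ^ N\<close> merely shifts coefficients, so it does
          not affect whether they lie in V.\<close>
        have "fps_to_fract h * (fps_X ^ N * z) = fps_to_fract h * y"
          using hz unfolding y(2)[symmetric] fps_to_fract_mult by (simp add: mult.left_commute)
        then have "fps_X ^ N * z = y" using h(1) by simp
        then show ?thesis using y(1) fps_over_X_power_multD by blast
      qed
      then have "z \<in> fps_over base_ring" unfolding base fps_over_def by blast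
      then show ?thesis by (rule fps_to_fract_dvdD[OF hz])
    qed simp
    then have "to_fract (g * j) / to_fract h \<in> base_ring" if "j \<in> J" for j
      using that to_fract_divide_in_base_ring_iff[OF h(1)] by blast
    then have "x \<in> ideal_inverse I" unfolding ideal_inverse_def IJ h(2) by auto
    then show "x \<in> base_ring" using I by blast
  qed
  moreover have "base_ring \<subseteq> ideal_inverse F"
    using F base_ring_subset_ideal_inverse unfolding nonzero_ideal_def by blast
  ultimately show "\<exists>F\<subseteq>I. nonzero_ideal F \<and> finitely_generated F \<and> ideal_inverse F = base_ring"
    by (intro exI[of _ F]) blast
qed

text \<open>The implication from (2) to (1) goes through (3): the Krull property makes D[[X]] an
  H-domain, and D[[X]] inherits complete integral closedness from D.\<close>

theorem corollary1p8:
  assumes "H_domain TYPE('a::idom)"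
  shows "(pvmd TYPE('a fps) \<longleftrightarrow> completely_integrally_closed TYPE('a)) \<and>
         (completely_integrally_closed TYPE('a) \<longleftrightarrow> krull_domain TYPE('a)) \<and>
         (krull_domain TYPE('a) \<longleftrightarrow> completely_integrally_closed TYPE('a fps))"
  using assms completely_integrally_closed_if_pvmd_fps completely_integrally_closed_fps
    completely_integrally_closed_if_fps completely_integrally_closed_if_krull_domain
    krull_domain_if_completely_integrally_closed_H_domain H_domain_fps
    pvmd_if_completely_integrally_closed_H_domain
  by blast

end
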